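(* Let $k\ge2$ be fixed and let $2\le r<\infty$. Assume that the observations are independent across clusters (with arbitrary dependence within clusters), that $$\frac{\big(\sum_{g=1}^{G}n_g^r\big)^{2/r}}{n}\le C<\infty\quad\text{and}\quad \max_{g\in[G]}\frac{n_g^2}{n}\to0\quad(n\to\infty),$$ that $$\lim_{M\to\infty}\sup_n\sup_{(i_1,\dots,i_k)\in[n]^k}E\big[|\varphi(W_{i_1},\dots,W_{i_k})|^r\,1\{|\varphi(W_{i_1},\dots,W_{i_k})|>M\}\big]=0,$$ and that $\sigma_{n,k}\ge\lambda>0$ for a constant $\lambda$ not depending on $n$. Then the cluster-robust plug-in estimator satisfies $\hat\sigma_{n,k}^2/\sigma_{n,k}^2\xrightarrow{p}1$ as $n\to\infty$.
   Context: For each $n$, the index set $[n]=\{1,\dots,n\}$ is partitioned into $G=G_n$ clusters $\mathcal G_1,\dots,\mathcal G_G$, with $n_g=\#\mathcal G_g$. The observations $W_1,\dots,W_n$ are random elements of a standard Borel space; "independent across clusters" means that the arrays $\{W_i\}_{i\in\mathcal G_g}$, $g\in[G]$, are mutually independent. A $k$-tuple of distinct indices is cluster-generic if its indices belong to $k$ distinct clusters. The kernel $\varphi(w_1,\dots,w_k)$ is real-valued, measurable, symmetric, and centred on cluster-generic tuples: $E[\varphi(W_{i_1},\dots,W_{i_k})]=0$ for every cluster-generic $(i_1,\dots,i_k)$. With $\mathcal P(n,k)=n(n-1)\cdots(n-k+1)$, $U_{n,k}=\frac1{\mathcal P(n,k)}\sum\varphi(W_{i_1},\dots,W_{i_k})$,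 the sum over ordered $k$-tuples of distinct indices in $[n]$. Target: let $\mathcal A_i$ be the set of ordered tuples $(i_2,\dots,i_k)$ such that $(i,i_2,\dots,i_k)$ is cluster-generic, $Q_{n,i}=\#\mathcal A_i$ (positive for large $n$), $\bar\varphi^{(1)}_{n,k}(W_i)=\frac1{Q_{n,i}}\sum_{(i_2,\dots,i_k)\in\mathcal A_i}E[\varphi(W_i,W_{i_2},\dots,W_{i_k})\mid W_i]$, and $\sigma_{n,k}\ge0$ with $\sigma_{n,k}^2=\frac{k^2}n\sum_{g=1}^GE\big[\big(\sum_{i\in\mathcal G_g}\bar\varphi^{(1)}_{n,k}(W_i)\big)^2\big]$. Estimator: $\tilde\varphi_{n,k,i}=\frac1{\mathcal P(n-1,k-1)}\sum\varphi(W_i,W_{i_2},\dots,W_{i_k})$, the sum over all ordered tuples $(i_2,\dots,i_k)$ of distinct indices in $[n]\setminus\{i\}$; $\hat\varphi^{(1)}_{n,k,i}=\tilde\varphi_{n,k,i}-U_{n,k}$; and $\hat\sigma_{n,k}^2=\frac{k^2}n\sum_{g=1}^G\big(\sum_{i\in\mathcal G_g}\hat\varphi^{(1)}_{n,k,i}\big)^2$. *)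

theory Defs
  imports "HOL-Probability.Probability"
begin

definition standard_borel_space :: "'a measure \<Rightarrow> bool" where
  "standard_borel_space S \<longleftrightarrow>
     (\<exists>X. topspace X = space S \<and> completely_metrizable_space X \<and> second_countable X \<and>
          sets S = sigma_sets (space S) {U. openin X U})"

text \<open>Tuples of indices are lists; \<open>P\<close> is the set of clusters, a partition of the index set.\<close>

definition distinct_tuples :: "nat \<Rightarrow> nat set \<Rightarrow> nat list set" where
  "distinct_tuples m A = {xs. length xs = m \<and> distinct xs \<and> set xs \<subseteq> A}"

definition cluster_generic :: "nat set set \<Rightarrow> nat list \<Rightarrow> bool" where
  "cluster_generic P xs \<longleftrightarrow>
     distinct xs \<and> set xs \<subseteq> \<Union>P \<and>
     (\<forall>x\<in>set xs. \<forall>y\<in>set xs. x \<noteq> y \<longrightarrow> \<not> (\<exists>C\<in>P. x \<in> C \<and> y \<in> C))"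

text \<open>A kernel of order \<open>k\<close> is a function on the product space \<open>PiM {..<k} (\<lambda>_. S)\<close>, whose
  points are functions that are \<open>undefined\<close> outside \<open>{..<k}\<close>; a permutation of \<open>{..<k}\<close> fixes all
  other numbers, so that composing with it stays in that space.\<close>

definition symmetric_kernel :: "nat \<Rightarrow> 'a measure \<Rightarrow> ((nat \<Rightarrow> 'a) \<Rightarrow> real) \<Rightarrow> bool" where
  "symmetric_kernel k S \<phi> \<longleftrightarrow>
     (\<forall>p w. p permutes {..<k} \<longrightarrow> w \<in> space (PiM {..<k} (\<lambda>_. S)) \<longrightarrow> \<phi> (w \<circ> p) = \<phi> w)"

definition kernel_at ::
  "((nat \<Rightarrow> 'a) \<Rightarrow> real) \<Rightarrow> (nat \<Rightarrow> 'w \<Rightarrow> 'a) \<Rightarrow> nat list \<Rightarrow> 'w \<Rightarrow> real" where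
  "kernel_at \<phi> W xs \<omega> = \<phi> (\<lambda>j\<in>{..<length xs}. W (xs ! j) \<omega>)"

definition falling_fact :: "nat \<Rightarrow> nat \<Rightarrow> real" where
  "falling_fact n k = (\<Prod>j<k. real n - real j)"

definition U_stat ::
  "((nat \<Rightarrow> 'a) \<Rightarrow> real) \<Rightarrow> nat \<Rightarrow> nat \<Rightarrow> (nat \<Rightarrow> 'w \<Rightarrow> 'a) \<Rightarrow> 'w \<Rightarrow> real" where
  "U_stat \<phi> k n W \<omega> =
     (\<Sum>xs\<in>distinct_tuples k {1..n}. kernel_at \<phi> W xs \<omega>) / falling_fact n k"

definition generic_completions :: "nat set set \<Rightarrow> nat \<Rightarrow> nat \<Rightarrow> nat list set" where
  "generic_completions P k i = {xs. length xs = k - 1 \<and> cluster_generic P (i # xs)}"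

text \<open>For small \<open>n\<close> (say \<open>n < k\<close>) there are no generic completions and the value below is \<open>0\<close>,
  because \<open>x / 0 = 0\<close>; a positive lower bound on \<open>target_sd\<close> can only be asked for large \<open>n\<close>.\<close>

definition mean_projection ::
  "'w measure \<Rightarrow> 'a measure \<Rightarrow> ((nat \<Rightarrow> 'a) \<Rightarrow> real) \<Rightarrow> nat \<Rightarrow> nat set set \<Rightarrow>
   (nat \<Rightarrow> 'w \<Rightarrow> 'a) \<Rightarrow> nat \<Rightarrow> 'w \<Rightarrow> real" where
  "mean_projection M S \<phi> k P W i \<omega> =
     (\<Sum>xs\<in>generic_completions P k i.
        real_cond_exp M (vimage_algebra (space M) (W i) S) (kernel_at \<phi> W (i # xs)) \<omega>)
     / real (card (generic_completions P k i))"

definition target_sd ::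
  "'w measure \<Rightarrow> 'a measure \<Rightarrow> ((nat \<Rightarrow> 'a) \<Rightarrow> real) \<Rightarrow> nat \<Rightarrow> nat \<Rightarrow> nat set set \<Rightarrow>
   (nat \<Rightarrow> 'w \<Rightarrow> 'a) \<Rightarrow> real" where
  "target_sd M S \<phi> k n P W =
     sqrt ((real k)\<^sup>2 / real n *
       (\<Sum>C\<in>P. LINT \<omega>|M. (\<Sum>i\<in>C. mean_projection M S \<phi> k P W i \<omega>)\<^sup>2))"

definition fixed_index_mean ::
  "((nat \<Rightarrow> 'a) \<Rightarrow> real) \<Rightarrow> nat \<Rightarrow> nat \<Rightarrow> (nat \<Rightarrow> 'w \<Rightarrow> 'a) \<Rightarrow> nat \<Rightarrow> 'w \<Rightarrow> real" where
  "fixed_index_mean \<phi> k n W i \<omega> =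
     (\<Sum>xs\<in>distinct_tuples (k - 1) ({1..n} - {i}). kernel_at \<phi> W (i # xs) \<omega>)
     / falling_fact (n - 1) (k - 1)"

definition est_projection ::
  "((nat \<Rightarrow> 'a) \<Rightarrow> real) \<Rightarrow> nat \<Rightarrow> nat \<Rightarrow> (nat \<Rightarrow> 'w \<Rightarrow> 'a) \<Rightarrow> nat \<Rightarrow> 'w \<Rightarrow> real" where
  "est_projection \<phi> k n W i \<omega> = fixed_index_mean \<phi> k n W i \<omega> - U_stat \<phi> k n W \<omega>"

definition variance_estimator ::
  "((nat \<Rightarrow> 'a) \<Rightarrow> real) \<Rightarrow> nat \<Rightarrow> nat \<Rightarrow> nat set set \<Rightarrow> (nat \<Rightarrow> 'w \<Rightarrow> 'a) \<Rightarrow> 'w \<Rightarrow> real" where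
  "variance_estimator \<phi> k n P W \<omega> =
     (real k)\<^sup>2 / real n * (\<Sum>C\<in>P. (\<Sum>i\<in>C. est_projection \<phi> k n W i \<omega>)\<^sup>2)"

definition independent_across_clusters ::
  "'w measure \<Rightarrow> 'a measure \<Rightarrow> nat set set \<Rightarrow> (nat \<Rightarrow> 'w \<Rightarrow> 'a) \<Rightarrow> bool" where
  "independent_across_clusters M S P W \<longleftrightarrow>
     prob_space.indep_vars M (\<lambda>C. PiM C (\<lambda>_. S)) (\<lambda>C \<omega>. \<lambda>i\<in>C. W i \<omega>) P"

text \<open>The probability space may vary along the sequence, as for triangular arrays.\<close>

definition converges_in_probability ::
  "(nat \<Rightarrow> 'w measure) \<Rightarrow> (nat \<Rightarrow> 'w \<Rightarrow> real) \<Rightarrow> real \<Rightarrow> bool" where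
  "converges_in_probability M X c \<longleftrightarrow>
     (\<forall>\<epsilon>>0. (\<lambda>n. measure (M n) {\<omega> \<in> space (M n). \<bar>X n \<omega> - c\<bar> > \<epsilon>}) \<longlonglongrightarrow> 0)"

end

theory Submission
  imports Defs
begin

text \<open>Let \<open>T\<^sub>g\<close> be the sum over a cluster of the projections in the target, \<open>S\<^sub>g\<close> the sum of the estimated
  projections, \<open>V\<close> the sum of the second moments of the \<open>T\<^sub>g\<close>, and \<open>m\<close> the largest cluster size. The
  ratio of the estimator to the target is the sum of the \<open>S\<^sub>g\<^sup>2\<close> divided by \<open>V\<close>, and \<open>V\<close> is at least a
  multiple of \<open>n\<close>.

  Two kernel values are uncorrelated when one tuple is generic and the tuples share no cluster;
  the same holds for kernel values with a common index after the conditional expectation given that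
  index is subtracted. All but a fraction of order \<open>m / n\<close> of the pairs of tuples are of this kind, so
  each estimated projection has mean square distance of order \<open>m / n\<close> from its target. Summing over
  clusters, the sum of the \<open>(S\<^sub>g - T\<^sub>g)\<^sup>2\<close> has mean of order \<open>m\<^sup>2 = o(n)\<close>.

  The sum of the independent variables \<open>T\<^sub>g\<^sup>2 / V\<close>, whose mean is 1, is close to 1 in \<open>L\<^sup>1\<close> by truncation
  at a small level \<open>e\<close>: the truncated sum has variance at most \<open>e\<close>, and the mean of the remainder is a
  Lindeberg sum, which uniform integrability and the bound on the cluster sizes make small. Dividing by
  \<open>V\<close> instead of \<open>n\<close> matters here, since \<open>V / n\<close> need not be bounded when \<open>r > 2\<close>.\<close>

section \<open>Counting tuples\<close>

lemma finite_lists_of_length: "finite A \<Longrightarrow> finite {xs. length xs = j \<and> set xs \<subseteq> A}"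
  using finite_lists_length_eq[of A j] by (simp add: conj_commute)

text \<open>A list is recovered from its entry at \<open>b\<close> and the list of its other
  entries: \<open>card A ^ (j - 1)\<close> choices for the others, then at most \<open>m\<close> for
  the entry. Letting \<open>E\<close> depend on the other entries covers an entry forced into the
  cluster of another entry of the same list.\<close>

lemma card_lists_coordinate:
  assumes A: "finite A" and b: "b < j"
    and E: "\<And>zs. finite (E zs)" "\<And>zs. card (E zs) \<le> m"
  shows "card {ys. length ys = j \<and> set ys \<subseteq> A \<and> ys ! b \<in> E (take b ys @ drop (Suc b) ys)}
    \<le> m * card A ^ (j - 1)" (is "card ?L \<le> _")
proof -
  let ?Z = "{zs. set zs \<subseteq> A \<and> length zs = j - 1}"
  let ?f = "\<lambda>ys. (take b ys @ drop (Suc b) ys, ys ! b)"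
  have Z: "finite ?Z" "card ?Z = card A ^ (j - 1)"
    using A by (simp_all add: finite_lists_length_eq card_lists_length_eq)
  have "inj_on ?f ?L"
  proof (rule inj_onI)
    fix xs ys assume "xs \<in> ?L" "ys \<in> ?L" and eq: "?f xs = ?f ys"
    then have len: "length xs = j" "length ys = j" by auto
    from eq have "take b xs = take b ys" "drop (Suc b) xs = drop (Suc b) ys" "xs ! b = ys ! b"
      using len by (auto simp: append_eq_append_conv)
    then show "xs = ys" using id_take_nth_drop[of b xs] id_take_nth_drop[of b ys] b len by simp
  qed
  moreover have "?f ` ?L \<subseteq> Sigma ?Z E"
    using b set_take_subset set_drop_subset by fastforce
  ultimately have "card ?L \<le> card (Sigma ?Z E)"
    using Z E by (intro card_inj_on_le[of ?f]) auto
  also have "\<dots> = (\<Sum>zs\<in>?Z. card (E zs))" using Z E by (intro card_SigmaI) auto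
  also have "\<dots> \<le> (\<Sum>zs\<in>?Z. m)" using E by (intro sum_mono) auto
  finally show ?thesis using Z by (simp add: mult.commute)
qed

lemma falling_fact_eq_0: "n < j \<Longrightarrow> falling_fact n j = 0"
  by (auto simp: falling_fact_def)

text \<open>The smallest factor is \<open>n - j + 1\<close>. With \<open>x = n / 2\<close> the
  number of tuples becomes comparable to a power of \<open>n\<close>, at the cost of a power of
  2.\<close>

lemma falling_fact_ge:
  assumes "0 \<le> x" "x \<le> real n - real j + 1"
  shows "x ^ j \<le> falling_fact n j"
proof -
  have "(\<Prod>l<j. x) \<le> (\<Prod>l<j. real n - real l)"
    using assms by (intro prod_mono) auto
  then show ?thesis by (simp add: falling_fact_def)
qed

lemma finite_distinct_tuples: "finite A \<Longrightarrow> finite (distinct_tuples j A)"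
  unfolding distinct_tuples_def
  by (rule finite_subset[OF _ finite_lists_of_length[of A j]]) auto

text \<open>For \<open>j\<close> beyond \<open>card A\<close> no such list exists, and the real
  product contains a factor 0.\<close>

lemma card_distinct_tuples:
  assumes "finite A"
  shows "real (card (distinct_tuples j A)) = falling_fact (card A) j"
proof (cases "j \<le> card A")
  case True
  have "falling_fact (card A) j = (\<Prod>l<j. real (card A - l))"
    unfolding falling_fact_def using True by (intro prod.cong) (auto simp: of_nat_diff)
  also have "(\<Prod>l<j. card A - l) = \<Prod>{card A - j + 1..card A}"
    using True by (intro prod.reindex_bij_witness[of _ "\<lambda>i. card A - i" "\<lambda>i. card A - i"]) auto
  then have "(\<Prod>l<j. real (card A - l)) = real (\<Prod>{card A - j + 1..card A})"
    by (metis of_nat_prod)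
  finally show ?thesis
    using card_lists_distinct_length_eq[OF assms True] by (simp add: distinct_tuples_def)
next
  case False
  have "distinct_tuples j A = {}"
    using False assms by (auto simp: distinct_tuples_def) (metis card_mono distinct_card)
  with False show ?thesis by (simp add: falling_fact_eq_0)
qed

section \<open>Clusters, separated index sets and the number of exceptional tuples\<close>

definition separated :: "nat set set \<Rightarrow> nat set \<Rightarrow> nat set \<Rightarrow> bool" where
  "separated P A B \<longleftrightarrow> (\<forall>C\<in>P. C \<inter> A = {} \<or> C \<inter> B = {})"

text \<open>For an index of the partitioned set this is its one cluster; any other number gets the
  empty set, so that the size bounds below hold for every argument.\<close>

definition cluster_of :: "nat set set \<Rightarrow> nat \<Rightarrow> nat set" where
  "cluster_of P i = \<Union>{C\<in>P. i \<in> C}"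

lemma separated_iff_cluster_of:
  "separated P A B \<longleftrightarrow> (\<forall>a\<in>A. \<forall>b\<in>B. b \<notin> cluster_of P a)"
  unfolding separated_def cluster_of_def by blast

lemma cluster_of_eq:
  assumes "partition_on A P" "C \<in> P" "i \<in> C"
  shows "cluster_of P i = C"
proof -
  have "D = C" if "D \<in> P" "i \<in> D" for D
    using assms that unfolding partition_on_def disjoint_def by blast
  with assms have "{D\<in>P. i \<in> D} = {C}" by blast
  then show ?thesis by (simp add: cluster_of_def)
qed

context
  fixes n m :: nat and P :: "nat set set"
  assumes part: "partition_on {1..n} P" and max_card: "\<And>C. C \<in> P \<Longrightarrow> card C \<le> m"
begin

lemma cluster_of_cases: "cluster_of P i = {} \<or> cluster_of P i \<in> P"
proof (cases "\<exists>C\<in>P. i \<in> C")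
  case True
  then show ?thesis using cluster_of_eq[OF part] by auto
qed (auto simp: cluster_of_def)

lemma finite_cluster_of: "finite (cluster_of P i)" 
  using cluster_of_cases[of i] part
  by (metis finite.emptyI finite_atLeastAtMost partition_onD1 finite_UnionD finite_subset Union_upper)

lemma card_cluster_of: "card (cluster_of P i) \<le> m"
  using cluster_of_cases[of i] max_card by (metis card.empty le0)

text \<open>Union bound over an element \<open>a\<close> of \<open>A\<close> and a position
  \<open>b\<close>: the entry at \<open>b\<close> must fall in the cluster of \<open>a\<close>,
  which leaves at most \<open>m\<close> values for it.\<close>

lemma card_not_separated:
  assumes "finite A"
  shows "card {ys. length ys = j \<and> set ys \<subseteq> {1..n} \<and> \<not> separated P A (set ys)}
    \<le> card A * j * m * n ^ (j - 1)"
proof -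
  let ?L = "\<lambda>a b. {ys. length ys = j \<and> set ys \<subseteq> {1..n} \<and> ys ! b \<in> cluster_of P a}"
  let ?U = "\<Union>(a, b)\<in>A \<times> {..<j}. ?L a b"
  have "{ys. length ys = j \<and> set ys \<subseteq> {1..n} \<and> \<not> separated P A (set ys)} \<subseteq> ?U"
    by (force simp: separated_iff_cluster_of in_set_conv_nth)
  moreover have "finite ?U"
    using assms by (auto intro!: finite_subset[OF _ finite_lists_of_length[of "{1..n}" j]])
  ultimately have "card {ys. length ys = j \<and> set ys \<subseteq> {1..n} \<and> \<not> separated P A (set ys)} \<le> card ?U"
    by (intro card_mono)
  also have "\<dots> \<le> (\<Sum>(a, b)\<in>A \<times> {..<j}. card (?L a b))"
    using card_UN_le[of "A \<times> {..<j}" "\<lambda>(a, b). ?L a b"] assms by (simp add: case_prod_unfold)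
  also have "\<dots> \<le> (\<Sum>(a, b)\<in>A \<times> {..<j}. m * n ^ (j - 1))"
  proof (rule sum_mono)
    fix p assume "p \<in> A \<times> {..<j}"
    then obtain a b where p: "p = (a, b)" and "b < j" by auto
    from card_lists_coordinate[OF finite_atLeastAtMost \<open>b < j\<close>, of "\<lambda>_. cluster_of P a" m 1 n]
    show "(case p of (a, b) \<Rightarrow> card (?L a b)) \<le> (case p of (a, b) \<Rightarrow> m * n ^ (j - 1))"
      using finite_cluster_of card_cluster_of p by simp
  qed
  finally show ?thesis by (simp add: algebra_simps card_cartesian_product)
qed

text \<open>The prefix \<open>ps\<close> is empty for the tuples of the U-statistic and \<open>[i]\<close> for the completions
  of an index \<open>i\<close>.\<close>

lemma card_not_generic:
  assumes ps: "length ps \<le> 1" "set ps \<subseteq> {1..n}"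
  shows "card {xs. length xs = j \<and> set xs \<subseteq> {1..n} \<and> distinct (ps @ xs) \<and> \<not> cluster_generic P (ps @ xs)}
    \<le> (j + 1) * j * m * n ^ (j - 1)" (is "card ?N \<le> _")
proof -
  let ?L = "\<lambda>a b. {xs. length xs = j \<and> set xs \<subseteq> {1..n} \<and>
    xs ! b \<in> cluster_of P ((ps @ take b xs @ drop (Suc b) xs) ! a)}"
  let ?U = "\<Union>(a, b)\<in>{..j} \<times> {..<j}. ?L a b"
  have "?N \<subseteq> ?U"
  proof clarify
    fix xs assume xs: "set xs \<subseteq> {1..n}" "distinct (ps @ xs)" "\<not> cluster_generic P (ps @ xs)"
      and j: "j = length xs"
    have "set (ps @ xs) \<subseteq> \<Union>P" using part xs ps by (auto simp: partition_on_def)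
    with xs obtain x y C where xy: "x \<in> set (ps @ xs)" "y \<in> set (ps @ xs)" "x \<noteq> y" "C \<in> P" "x \<in> C" "y \<in> C"
      unfolding cluster_generic_def by blast
    \<comment> \<open>Positions instead of entries, in increasing order: as \<open>ps\<close> has at
      most one entry, the later position \<open>b\<close> lies in \<open>xs\<close>.\<close>
    obtain a b where ab: "a < length (ps @ xs)" "b < length (ps @ xs)" "(ps @ xs) ! a \<in> C" "(ps @ xs) ! b \<in> C" "a < b"
    proof -
      obtain a b where *: "a < length (ps @ xs)" "b < length (ps @ xs)" "(ps @ xs) ! a = x" "(ps @ xs) ! b = y"
        using xy by (metis in_set_conv_nth)
      then have "a \<noteq> b" using xy by auto
      then show ?thesis using that[of a b] that[of b a] * xy by (cases "a < b") auto
    qed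
    define b' where "b' = b - length ps"
    have b': "b' < length xs" "b = length ps + b'" using ab ps(1) by (auto simp: b'_def)
    have "xs ! b' \<in> cluster_of P ((ps @ xs) ! a)"
      using ab b' xy by (auto simp: cluster_of_def nth_append)
    \<comment> \<open>Since \<open>a < b\<close>, deleting position \<open>b\<close> does not move
      the entry at \<open>a\<close>; the forbidden set is thus a function of the remaining entries,
      as the counting lemma requires.\<close>
    also have "(ps @ xs) ! a = (ps @ take b' xs @ drop (Suc b') xs) ! a"
      using ab b' by (auto simp: nth_append)
    finally show "xs \<in> (\<Union>(a, b)\<in>{..length xs} \<times> {..<length xs}. {ys. length ys = length xs \<and> set ys \<subseteq> {1..n} \<and>
        ys ! b \<in> cluster_of P ((ps @ take b ys @ drop (Suc b) ys) ! a)})"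
      using b' ab ps(1) xs by (intro UN_I[of "(a, b')"]) auto
  qed
  moreover have "finite ?U"
    by (auto intro!: finite_subset[OF _ finite_lists_of_length[of "{1..n}" j]])
  ultimately have "card ?N \<le> card ?U"
    by (intro card_mono)
  also have "\<dots> \<le> (\<Sum>(a, b)\<in>{..j} \<times> {..<j}. card (?L a b))"
    using card_UN_le[of "{..j} \<times> {..<j}" "\<lambda>(a, b). ?L a b"] by (simp add: case_prod_unfold)
  also have "\<dots> \<le> (\<Sum>(a, b)\<in>{..j} \<times> {..<j}. m * n ^ (j - 1))"
  proof (rule sum_mono)
    fix p assume "p \<in> {..j} \<times> {..<j}"
    then obtain a b where p: "p = (a, b)" and "b < j" by auto
    \<comment> \<open>When \<open>a\<close> is out of range for \<open>ps @ zs\<close> the entry is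
      unspecified, which is harmless because the size bounds on \<open>cluster_of\<close> hold for
      every number.\<close>
    from card_lists_coordinate[OF finite_atLeastAtMost \<open>b < j\<close>, of "\<lambda>zs. cluster_of P ((ps @ zs) ! a)" m 1 n]
    show "(case p of (a, b) \<Rightarrow> card (?L a b)) \<le> (case p of (a, b) \<Rightarrow> m * n ^ (j - 1))"
      using finite_cluster_of card_cluster_of p by simp
  qed
  finally show ?thesis by (simp add: algebra_simps card_cartesian_product)
qed

end

section \<open>Second moments and independence\<close>

text \<open>Measurability is part of the notion because it does not follow from measurability of the
  square.\<close>

definition square_integrable :: "'w measure \<Rightarrow> ('w \<Rightarrow> real) \<Rightarrow> bool" where
  "square_integrable M f \<longleftrightarrow> f \<in> borel_measurable M \<and> integrable M (\<lambda>x. (f x)\<^sup>2)"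

lemma square_integrable_bound:
  assumes "f \<in> borel_measurable M" "integrable M g" "AE x in M. (f x)\<^sup>2 \<le> g x"
  shows "square_integrable M f"
  unfolding square_integrable_def using assms
  by (auto intro!: Bochner_Integration.integrable_bound[OF assms(2)])

lemma square_integrable_mult:
  assumes "square_integrable M f" "square_integrable M g"
  shows "integrable M (\<lambda>x. f x * g x)"
proof (rule Bochner_Integration.integrable_bound)
  show "integrable M (\<lambda>x. (f x)\<^sup>2 + (g x)\<^sup>2)" "(\<lambda>x. f x * g x) \<in> borel_measurable M"
    using assms by (auto simp: square_integrable_def)
  have "\<bar>a * b\<bar> \<le> a\<^sup>2 + b\<^sup>2" for a b :: real
    using sum_squares_bound[of "\<bar>a\<bar>" "\<bar>b\<bar>"] mult_nonneg_nonneg[of "\<bar>a\<bar>" "\<bar>b\<bar>"]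
    unfolding abs_mult power2_abs by linarith
  then show "AE x in M. norm (f x * g x) \<le> norm ((f x)\<^sup>2 + (g x)\<^sup>2)" by simp
qed

lemma square_integrable_sum:
  assumes "\<And>i. i \<in> I \<Longrightarrow> square_integrable M (f i)"
  shows "square_integrable M (\<lambda>x. \<Sum>i\<in>I. f i x)"
proof (cases "finite I")
  case True
  have "integrable M (\<lambda>x. \<Sum>i\<in>I. \<Sum>j\<in>I. f i x * f j x)"
    using assms by (intro Bochner_Integration.integrable_sum square_integrable_mult) auto
  then show ?thesis
    using assms by (auto simp: square_integrable_def power2_eq_square sum_product intro!: borel_measurable_sum)
qed (simp add: square_integrable_def)

lemma square_integrable_cmult: "square_integrable M f \<Longrightarrow> square_integrable M (\<lambda>x. a * f x)"
  by (auto simp: square_integrable_def power_mult_distrib)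

lemma square_integrable_divide: "square_integrable M f \<Longrightarrow> square_integrable M (\<lambda>x. f x / a)"
  by (auto simp: square_integrable_def power_divide)

lemma square_integrable_diff:
  assumes "square_integrable M f" "square_integrable M g"
  shows "square_integrable M (\<lambda>x. f x - g x)"
proof -
  have "integrable M (\<lambda>x. (f x)\<^sup>2 + (g x)\<^sup>2 - 2 * (f x * g x))"
    using assms square_integrable_mult[OF assms] by (auto simp: square_integrable_def)
  then show ?thesis
    using assms by (auto simp: square_integrable_def power2_diff algebra_simps)
qed

text \<open>Cauchy-Schwarz for finite sums, valid under any dependence, as is needed within a
  cluster.\<close>

lemma integral_sum_square_le:
  assumes "finite I" "\<And>i. i \<in> I \<Longrightarrow> square_integrable M (f i)"
    and "\<And>i. i \<in> I \<Longrightarrow> (LINT x|M. (f i x)\<^sup>2) \<le> c"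
  shows "(LINT x|M. (\<Sum>i\<in>I. f i x)\<^sup>2) \<le> (real (card I))\<^sup>2 * c"
proof -
  have "(LINT x|M. (\<Sum>i\<in>I. f i x)\<^sup>2) \<le> (LINT x|M. (\<Sum>i\<in>I. (f i x)\<^sup>2) * real (card I))"
    using assms square_integrable_sum[of I M f] sum_squared_le_sum_of_squares[of _ I]
    by (intro integral_mono) (auto simp: square_integrable_def)
  also have "\<dots> = real (card I) * (\<Sum>i\<in>I. LINT x|M. (f i x)\<^sup>2)"
    using assms by (simp add: mult.commute square_integrable_def)
  also have "\<dots> \<le> real (card I) * (\<Sum>i\<in>I. c)"
    using assms by (intro mult_left_mono sum_mono) auto
  finally show ?thesis by (simp add: power2_eq_square)
qed

text \<open>The inequality 2ab \<le> a^2 + b^2 serves in place of Cauchy-Schwarz, since both factors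
  have the same bound \<open>c\<close>.\<close>

lemma integral_mult_le:
  assumes "square_integrable M f" "square_integrable M g"
    "(LINT x|M. (f x)\<^sup>2) \<le> c" "(LINT x|M. (g x)\<^sup>2) \<le> c"
  shows "(LINT x|M. f x * g x) \<le> c"
proof -
  have amgm: "a * b * 2 \<le> a\<^sup>2 + b\<^sup>2" for a b :: real
    using sum_squares_bound[of a b] by (simp add: field_simps)
  have "(LINT x|M. f x * g x) \<le> (LINT x|M. ((f x)\<^sup>2 + (g x)\<^sup>2) / 2)"
    using assms square_integrable_mult[OF assms(1,2)]
    by (intro integral_mono) (auto simp: square_integrable_def amgm)
  also have "\<dots> = ((LINT x|M. (f x)\<^sup>2) + (LINT x|M. (g x)\<^sup>2)) / 2"
    using assms by (simp add: square_integrable_def)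
  finally show ?thesis using assms by simp
qed

text \<open>After expanding the square, a pair can contribute only if its first index is exceptional
  (\<open>N\<close>) or the two are related by \<open>R\<close>; there are at most
  \<open>card I * q1\<close> pairs of the first kind and \<open>card I * q2\<close> of the second,
  each worth at most \<open>c\<close>.\<close>

lemma integral_sum_square_le_uncorrelated:
  fixes q1 q2 :: real
  assumes I: "finite I" and f: "\<And>i. i \<in> I \<Longrightarrow> square_integrable M (f i)"
    and c: "\<And>i. i \<in> I \<Longrightarrow> (LINT x|M. (f i x)\<^sup>2) \<le> c" "0 \<le> c"
    and N: "N \<subseteq> I" "real (card N) \<le> q1"
    and R: "\<And>i. i \<in> I \<Longrightarrow> real (card {j\<in>I. R i j}) \<le> q2"
    and uncorr: "\<And>i j. \<lbrakk>i \<in> I - N; j \<in> I; \<not> R i j\<rbrakk> \<Longrightarrow> (LINT x|M. f i x * f j x) = 0"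
  shows "(LINT x|M. (\<Sum>i\<in>I. f i x)\<^sup>2) \<le> c * real (card I) * (q1 + q2)"
proof -
  have "(LINT x|M. (\<Sum>i\<in>I. f i x)\<^sup>2) = (LINT x|M. (\<Sum>i\<in>I. \<Sum>j\<in>I. f i x * f j x))"
    by (simp add: power2_eq_square sum_product)
  also have "\<dots> = (\<Sum>i\<in>I. \<Sum>j\<in>I. LINT x|M. f i x * f j x)"
    using f by (simp add: square_integrable_mult)
  also have "\<dots> \<le> (\<Sum>i\<in>I. \<Sum>j\<in>I. c * (of_bool (i \<in> N) + of_bool (R i j)))"
  proof (intro sum_mono)
    fix i j assume ij: "i \<in> I" "j \<in> I"
    have "(LINT x|M. f i x * f j x) \<le> c"
      using ij by (intro integral_mult_le f c)
    then show "(LINT x|M. f i x * f j x) \<le> c * (of_bool (i \<in> N) + of_bool (R i j))"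
      using uncorr[of i j] ij c(2) by (cases "i \<in> N"; cases "R i j") auto
  qed
  also have "\<dots> = c * (real (card I) * real (card N) + (\<Sum>i\<in>I. real (card {j\<in>I. R i j})))"
  proof -
    have "(\<Sum>j\<in>I. of_bool (R i j)) = real (card {j\<in>I. R i j})" for i
      using I by (simp add: of_bool_def sum.If_cases Collect_conj_eq)
    moreover have "(\<Sum>i\<in>I. of_bool (i \<in> N)) = real (card N)"
      using I N(1) by (simp add: of_bool_def sum.If_cases Int_absorb1)
    ultimately show ?thesis
      by (simp add: sum_distrib_left[symmetric] sum.distrib)
  qed
  also have "\<dots> \<le> c * (real (card I) * q1 + (\<Sum>i\<in>I. q2))"
    using c N R by (intro mult_left_mono add_mono sum_mono) auto
  finally show ?thesis by (simp add: algebra_simps)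
qed

section \<open>Integrating out an independent variable; conditional expectations\<close>

context prob_space
begin

lemma square_integrable_const: "square_integrable M (\<lambda>_. a)"
  by (simp add: square_integrable_def)

lemma square_integrable_imp_integrable: "square_integrable M f \<Longrightarrow> integrable M f"
  using square_integrable_mult[OF _ square_integrable_const[of 1]] by simp

text \<open>The joint law is a product, so this is Fubini: \<open>B\<close> is replaced by an
  independent copy, evaluated at \<open>\<omega>'\<close>.\<close>

lemma indep_var_integral:
  assumes indep: "indep_var N1 Z N2 B" and F[measurable]: "F \<in> borel_measurable (N1 \<Otimes>\<^sub>M N2)"
    and int: "integrable M (\<lambda>\<omega>. F (Z \<omega>, B \<omega>) :: real)"
  shows "integrable M (\<lambda>\<omega>. \<integral>\<omega>'. F (Z \<omega>, B \<omega>') \<partial>M)"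
    and "(\<integral>\<omega>. F (Z \<omega>, B \<omega>) \<partial>M) = (\<integral>\<omega>. (\<integral>\<omega>'. F (Z \<omega>, B \<omega>') \<partial>M) \<partial>M)"
proof -
  have Z[measurable]: "Z \<in> M \<rightarrow>\<^sub>M N1" and B[measurable]: "B \<in> M \<rightarrow>\<^sub>M N2"
    and eq: "distr M N1 Z \<Otimes>\<^sub>M distr M N2 B = distr M (N1 \<Otimes>\<^sub>M N2) (\<lambda>x. (Z x, B x))"
    using indep unfolding indep_var_distribution_eq by auto
  interpret D1: prob_space "distr M N1 Z" by (rule prob_space_distr) fact
  interpret D2: prob_space "distr M N2 B" by (rule prob_space_distr) fact
  interpret pair_sigma_finite "distr M N1 Z" "distr M N2 B" ..
  have int': "integrable (distr M N1 Z \<Otimes>\<^sub>M distr M N2 B) F"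
    unfolding eq using int by (subst integrable_distr_eq) auto
  have inner: "(\<integral>b. F (z, b) \<partial>distr M N2 B) = (\<integral>\<omega>'. F (z, B \<omega>') \<partial>M)" if "z \<in> space N1" for z
    using that by (subst integral_distr) auto
  have h: "(\<lambda>z. \<integral>\<omega>'. F (z, B \<omega>') \<partial>M) \<in> borel_measurable N1"
    by measurable
  have "integrable (distr M N1 Z) (\<lambda>z. \<integral>\<omega>'. F (z, B \<omega>') \<partial>M)"
    using integrable_fst'[OF int'] inner by (subst (asm) Bochner_Integration.integrable_cong) auto
  then show "integrable M (\<lambda>\<omega>. \<integral>\<omega>'. F (Z \<omega>, B \<omega>') \<partial>M)"
    using h by (subst (asm) integrable_distr_eq) auto
  have "(\<integral>\<omega>. F (Z \<omega>, B \<omega>) \<partial>M) = (\<integral>x. F x \<partial>(distr M N1 Z \<Otimes>\<^sub>M distr M N2 B))"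
    unfolding eq by (subst integral_distr) auto
  also have "\<dots> = (\<integral>z. (\<integral>\<omega>'. F (z, B \<omega>') \<partial>M) \<partial>distr M N1 Z)"
    unfolding integral_fst'[OF int', symmetric]
    using inner by (intro Bochner_Integration.integral_cong) auto
  also have "\<dots> = (\<integral>\<omega>. (\<integral>\<omega>'. F (Z \<omega>, B \<omega>') \<partial>M) \<partial>M)"
    using h by (subst integral_distr) auto
  finally show "(\<integral>\<omega>. F (Z \<omega>, B \<omega>) \<partial>M) = (\<integral>\<omega>. (\<integral>\<omega>'. F (Z \<omega>, B \<omega>') \<partial>M) \<partial>M)" .
qed

text \<open>For fixed \<open>Z\<close> the factor \<open>G\<close> is a constant and the other
  factor has mean 0. \<open>Z\<close> may carry more coordinates than \<open>p\<close> sees through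
  \<open>t\<close>, and \<open>G\<close> may depend on all of them.\<close>

lemma indep_var_integral_centred:
  assumes indep: "indep_var N1 Z N2 B" and p[measurable]: "p \<in> borel_measurable (S \<Otimes>\<^sub>M N2)"
    and t[measurable]: "t \<in> N1 \<rightarrow>\<^sub>M S" and G[measurable]: "G \<in> borel_measurable N1"
    and int: "integrable M (\<lambda>\<omega>. (p (t (Z \<omega>), B \<omega>) - (\<integral>\<omega>'. p (t (Z \<omega>), B \<omega>') \<partial>M)) * G (Z \<omega>) :: real)"
  shows "(\<integral>\<omega>. (p (t (Z \<omega>), B \<omega>) - (\<integral>\<omega>'. p (t (Z \<omega>), B \<omega>') \<partial>M)) * G (Z \<omega>) \<partial>M) = 0"
proof -
  have [measurable]: "B \<in> M \<rightarrow>\<^sub>M N2" using indep unfolding indep_var_distribution_eq by auto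
  define h where "h a = (\<integral>\<omega>'. p (a, B \<omega>') \<partial>M)" for a
  have h[measurable]: "h \<in> borel_measurable S" unfolding h_def by measurable
  define F where "F = (\<lambda>(z, b). (p (t z, b) - h (t z)) * G z)"
  have F: "F \<in> borel_measurable (N1 \<Otimes>\<^sub>M N2)" unfolding F_def by measurable
  have inner: "(\<integral>\<omega>'. F (z, B \<omega>') \<partial>M) = 0" for z
  proof (cases "integrable M (\<lambda>\<omega>'. p (t z, B \<omega>'))")
    case True
    then show ?thesis by (simp add: F_def h_def prob_space)
  next
    \<comment> \<open>If the section of \<open>p\<close> is not integrable, its integral is 0 by
      convention; then \<open>h\<close> vanishes there and the integral of \<open>F\<close> is a
      multiple of that same 0.\<close>
    case False
    then have "h (t z) = 0" by (simp add: h_def not_integrable_integral_eq)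
    with False show ?thesis using h_def[of "t z"] by (simp add: F_def)
  qed
  have "(\<integral>\<omega>. F (Z \<omega>, B \<omega>) \<partial>M) = (\<integral>\<omega>. (\<integral>\<omega>'. F (Z \<omega>, B \<omega>') \<partial>M) \<partial>M)"
    by (rule indep_var_integral(2)[OF indep F]) (use int in \<open>simp add: F_def h_def\<close>)
  also have "\<dots> = 0" by (simp add: inner)
  finally show ?thesis by (simp add: F_def h_def)
qed

lemma sigma_finite_subalgebra_vimage_algebra:
  assumes "A \<in> M \<rightarrow>\<^sub>M S"
  shows "sigma_finite_subalgebra M (vimage_algebra (space M) A S)"
proof -
  have "subalgebra M (vimage_algebra (space M) A S)"
    using assms measurable_sets[OF assms] measurable_space[OF assms]
    by (auto simp: subalgebra_def sets_vimage_algebra2)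
  then interpret finite_measure_subalgebra M "vimage_algebra (space M) A S"
    by unfold_locales
  show ?thesis by (rule sigma_finite_subalgebra_axioms)
qed

text \<open>The library states \<open>indep_var\<close> only for two variables with values in the same type, so the
  conditioning variable \<open>A\<close> enters as a function of a variable \<open>Z\<close> of the type of \<open>B\<close>.\<close>

lemma cond_exp_indep_var:
  assumes indep: "indep_var N1 Z N B" and t[measurable]: "t \<in> N1 \<rightarrow>\<^sub>M S" and A_eq: "\<And>\<omega>. A \<omega> = t (Z \<omega>)" and p[measurable]: "p \<in> borel_measurable (S \<Otimes>\<^sub>M N)"
    and int: "integrable M (\<lambda>\<omega>. p (A \<omega>, B \<omega>) :: real)"
  shows "AE \<omega> in M. real_cond_exp M (vimage_algebra (space M) A S) (\<lambda>\<omega>. p (A \<omega>, B \<omega>)) \<omega>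
    = (\<integral>\<omega>'. p (A \<omega>, B \<omega>') \<partial>M)"
proof -
  have Z[measurable]: "Z \<in> M \<rightarrow>\<^sub>M N1" and B[measurable]: "B \<in> M \<rightarrow>\<^sub>M N"
    using indep unfolding indep_var_distribution_eq by auto
  have A[measurable]: "A \<in> M \<rightarrow>\<^sub>M S" unfolding A_eq[abs_def] by measurable
  let ?F = "vimage_algebra (space M) A S"
  interpret sigma_finite_subalgebra M ?F by (rule sigma_finite_subalgebra_vimage_algebra) fact
  have h: "(\<lambda>a. \<integral>\<omega>'. p (a, B \<omega>') \<partial>M) \<in> borel_measurable S" by measurable
  show ?thesis
  proof (rule real_cond_exp_charact)
    show "integrable M (\<lambda>\<omega>. \<integral>\<omega>'. p (A \<omega>, B \<omega>') \<partial>M)"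
      using indep_var_integral(1)[OF indep, of "\<lambda>(z, b). p (t z, b)"] int by (simp add: A_eq)
    have "A \<in> measurable ?F S"
      using measurable_space[OF A] by (intro measurable_vimage_algebra1) auto
    then show "(\<lambda>\<omega>. \<integral>\<omega>'. p (A \<omega>, B \<omega>') \<partial>M) \<in> borel_measurable ?F"
      using h by (rule measurable_compose)
    \<comment> \<open>Events of \<open>?F\<close> are preimages under \<open>A\<close>: their
      indicators are functions of \<open>A\<close> and can be moved into the integrand before
      \<open>B\<close> is integrated out.\<close>
    fix E assume "E \<in> sets ?F"
    then obtain D where [measurable]: "D \<in> sets S" and E: "E = A -` D \<inter> space M"
      using measurable_space[OF A] by (subst (asm) sets_vimage_algebra2) auto
    have ind: "(indicator E \<omega> :: real) = indicator D (A \<omega>)" if "\<omega> \<in> space M" for \<omega>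
      using that by (auto simp: E indicator_def)
    have int': "integrable M (\<lambda>\<omega>. indicator D (A \<omega>) * p (A \<omega>, B \<omega>))"
    proof -
      have "integrable M (\<lambda>\<omega>. indicator E \<omega> *\<^sub>R p (A \<omega>, B \<omega>))"
        unfolding E by (intro integrable_mult_indicator int) measurable
      then show ?thesis using ind by (subst (asm) Bochner_Integration.integrable_cong) auto
    qed
    have "(\<integral>\<omega>\<in>E. p (A \<omega>, B \<omega>) \<partial>M) = (\<integral>\<omega>. indicator D (A \<omega>) * p (A \<omega>, B \<omega>) \<partial>M)"
      unfolding set_lebesgue_integral_def using ind by (intro Bochner_Integration.integral_cong) auto
    also have "\<dots> = (\<integral>\<omega>. (\<integral>\<omega>'. indicator D (A \<omega>) * p (A \<omega>, B \<omega>') \<partial>M) \<partial>M)"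
      using indep_var_integral(2)[OF indep, of "\<lambda>(z, b). indicator D (t z) * p (t z, b)"] int' by (simp add: A_eq)
    also have "\<dots> = (\<integral>\<omega>\<in>E. (\<integral>\<omega>'. p (A \<omega>, B \<omega>') \<partial>M) \<partial>M)"
      unfolding set_lebesgue_integral_def using ind by (intro Bochner_Integration.integral_cong) auto
    finally show "(\<integral>\<omega>\<in>E. p (A \<omega>, B \<omega>) \<partial>M) = (\<integral>\<omega>\<in>E. (\<integral>\<omega>'. p (A \<omega>, B \<omega>') \<partial>M) \<partial>M)" .
  qed (fact int)
qed

text \<open>Conditional Jensen, then the tower property. The conclusion concerns any almost sure
  version \<open>Y\<close>, which later is an explicit function of the conditioning
  observation.\<close>

lemma real_cond_exp_convex:
  fixes q :: "real \<Rightarrow> real"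
  assumes A: "A \<in> M \<rightarrow>\<^sub>M S" and X: "integrable M X"
    and q: "convex_on UNIV q" "q \<in> borel_measurable borel" "integrable M (\<lambda>\<omega>. q (X \<omega>))"
    and Y: "AE \<omega> in M. real_cond_exp M (vimage_algebra (space M) A S) X \<omega> = Y \<omega>"
      "Y \<in> borel_measurable M"
  shows "integrable M (\<lambda>\<omega>. q (Y \<omega>))" and "(\<integral>\<omega>. q (Y \<omega>) \<partial>M) \<le> (\<integral>\<omega>. q (X \<omega>) \<partial>M)"
proof -
  let ?E = "real_cond_exp M (vimage_algebra (space M) A S)"
  interpret sigma_finite_subalgebra M "vimage_algebra (space M) A S"
    by (rule sigma_finite_subalgebra_vimage_algebra) fact
  have meas: "(\<lambda>\<omega>. q (?E X \<omega>)) \<in> borel_measurable M" "(\<lambda>\<omega>. q (Y \<omega>)) \<in> borel_measurable M"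
    using q(2) Y(2) by (auto intro: measurable_compose)
  have "integrable M (\<lambda>\<omega>. q (?E X \<omega>))"
    by (rule integrable_convex_cond_exp[where I=UNIV]) (use X q emeasure_space_1 in auto)
  moreover have eq: "AE \<omega> in M. q (?E X \<omega>) = q (Y \<omega>)"
    using Y(1) by auto
  ultimately show int: "integrable M (\<lambda>\<omega>. q (Y \<omega>))"
    using meas by (subst (asm) integrable_cong_AE) auto
  have "AE \<omega> in M. q (?E X \<omega>) \<le> ?E (\<lambda>\<omega>. q (X \<omega>)) \<omega>"
    by (rule real_cond_exp_jensens_inequality(2)[where I=UNIV]) (use X q in auto)
  then have "(\<integral>\<omega>. q (Y \<omega>) \<partial>M) \<le> (\<integral>\<omega>. ?E (\<lambda>\<omega>. q (X \<omega>)) \<omega> \<partial>M)"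
    using eq int q(3) by (intro integral_mono_AE real_cond_exp_int) auto
  then show "(\<integral>\<omega>. q (Y \<omega>) \<partial>M) \<le> (\<integral>\<omega>. q (X \<omega>) \<partial>M)"
    using real_cond_exp_int(2)[OF q(3)] by simp
qed

end

section \<open>Projections of a clustered kernel\<close>

text \<open>One row of the array. All bounds below are explicit in \<open>n\<close>,
  \<open>m\<close> and \<open>c\<close>, so that limits are taken only in the final theorem. The
  moment bounds \<open>sq\<close> and \<open>sq_le\<close> range over all tuples, also those with
  repeated indices.\<close>

locale clustered_kernel = prob_space M for M :: "'w measure" +
  fixes S :: "'a measure" and W :: "nat \<Rightarrow> 'w \<Rightarrow> 'a" and P :: "nat set set"
    and \<phi> :: "(nat \<Rightarrow> 'a) \<Rightarrow> real" and k n m :: nat and c :: real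
  assumes k: "1 \<le> k" and n: "1 \<le> n"
    and part: "partition_on {1..n} P"
    and max_card: "\<And>C. C \<in> P \<Longrightarrow> card C \<le> m"
    and obs: "\<And>i. i \<in> {1..n} \<Longrightarrow> W i \<in> measurable M S"
    and indep: "independent_across_clusters M S P W"
    and kernel_meas: "\<phi> \<in> borel_measurable (PiM {..<k} (\<lambda>_. S))"
    and centred: "\<And>xs. length xs = k \<Longrightarrow> cluster_generic P xs \<Longrightarrow> (LINT \<omega>|M. kernel_at \<phi> W xs \<omega>) = 0"
    and sq: "\<And>xs. length xs = k \<Longrightarrow> set xs \<subseteq> {1..n} \<Longrightarrow> square_integrable M (kernel_at \<phi> W xs)"
    and sq_le: "\<And>xs. length xs = k \<Longrightarrow> set xs \<subseteq> {1..n} \<Longrightarrow> (LINT \<omega>|M. (kernel_at \<phi> W xs \<omega>)\<^sup>2) \<le> c"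
begin

definition obs_at :: "nat set \<Rightarrow> 'w \<Rightarrow> nat \<Rightarrow> 'a" where
  "obs_at J \<omega> = (\<lambda>i\<in>J. W i \<omega>)"

text \<open>The first argument of the kernel is separated from the rest, so that conditioning on one
  observation becomes integration over the second component of a pair.\<close>

definition split_kernel :: "nat list \<Rightarrow> 'a \<times> (nat \<Rightarrow> 'a) \<Rightarrow> real" where
  "split_kernel xs = (\<lambda>(a, b). \<phi> (\<lambda>j\<in>{..<k}. case j of 0 \<Rightarrow> a | Suc l \<Rightarrow> b (xs ! l)))"

text \<open>For a generic completion \<open>xs\<close>, an explicit version of the conditional
  expectation of the kernel given its first observation, as a function of the value of that
  observation.\<close>

definition partial_mean :: "nat list \<Rightarrow> 'a \<Rightarrow> real" where
  "partial_mean xs a = (\<integral>\<omega>. split_kernel xs (a, obs_at (set xs) \<omega>) \<partial>M)"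

text \<open>The version of \<open>mean_projection\<close> built from these functions; it is 0 when
  there are no generic completions.\<close>

definition proj :: "nat \<Rightarrow> 'a \<Rightarrow> real" where
  "proj i a = (\<Sum>xs\<in>generic_completions P k i. partial_mean xs a)
     / real (card (generic_completions P k i))"

lemma c_nonneg: "0 \<le> c"
proof -
  have "0 \<le> (LINT \<omega>|M. (kernel_at \<phi> W (replicate k 1) \<omega>)\<^sup>2)" by simp
  also have "\<dots> \<le> c" using n by (intro sq_le) auto
  finally show ?thesis .
qed

lemma Union_P: "\<Union>P = {1..n}"
  using part by (simp add: partition_on_def)

lemma obs_at_measurable:
  assumes "J \<subseteq> {1..n}"
  shows "obs_at J \<in> M \<rightarrow>\<^sub>M PiM J (\<lambda>_. S)"
  unfolding obs_at_def using assms obs by (intro measurable_restrict) auto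

lemma split_kernel_measurable:
  assumes "length xs = k - 1"
  shows "split_kernel xs \<in> borel_measurable (S \<Otimes>\<^sub>M PiM (set xs) (\<lambda>_. S))"
proof -
  have "(\<lambda>ab. \<lambda>j\<in>{..<k}. case j of 0 \<Rightarrow> fst ab | Suc l \<Rightarrow> snd ab (xs ! l))
    \<in> S \<Otimes>\<^sub>M PiM (set xs) (\<lambda>_. S) \<rightarrow>\<^sub>M PiM {..<k} (\<lambda>_. S)"
  proof (rule measurable_restrict)
    fix j assume j: "j \<in> {..<k}"
    show "(\<lambda>ab. case j of 0 \<Rightarrow> fst ab | Suc l \<Rightarrow> snd ab (xs ! l))
        \<in> S \<Otimes>\<^sub>M PiM (set xs) (\<lambda>_. S) \<rightarrow>\<^sub>M S"
      using j assms
      by (cases j) (auto intro!: measurable_compose[OF measurable_snd measurable_component_singleton])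
  qed
  from measurable_compose[OF this kernel_meas] show ?thesis
    by (simp add: split_kernel_def case_prod_unfold)
qed

lemma kernel_at_split:
  assumes "length xs = k - 1"
  shows "kernel_at \<phi> W (i # xs) \<omega> = split_kernel xs (W i \<omega>, obs_at (set xs) \<omega>)"
  unfolding kernel_at_def split_kernel_def obs_at_def prod.case using assms k
  by (intro arg_cong[of _ _ \<phi>] restrict_ext) (auto split: nat.splits)

lemma kernel_at_coordinates_measurable:
  assumes "set xs \<subseteq> J" "length xs = k"
  shows "kernel_at \<phi> (\<lambda>i z. z i) xs \<in> borel_measurable (PiM J (\<lambda>_. S))"
proof -
  have "(\<lambda>z. \<lambda>j\<in>{..<k}. z (xs ! j)) \<in> PiM J (\<lambda>_. S) \<rightarrow>\<^sub>M PiM {..<k} (\<lambda>_. S)"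
    using assms by (intro measurable_restrict measurable_component_singleton) auto
  from measurable_compose[OF this kernel_meas] show ?thesis
    using assms by (simp add: kernel_at_def[abs_def])
qed

lemma kernel_at_coordinates:
  assumes "set xs \<subseteq> J"
  shows "kernel_at \<phi> W xs \<omega> = kernel_at \<phi> (\<lambda>i z. z i) xs (obs_at J \<omega>)"
  unfolding kernel_at_def obs_at_def using assms
  by (intro arg_cong[of _ _ \<phi>] restrict_ext) (auto simp: subset_iff)

text \<open>Independence is given for whole clusters. Separated sets meet disjoint families of
  clusters, and the observations in each set are read off from the arrays of its own family by
  \<open>t\<close>.\<close>

lemma indep_var_obs_at:
  assumes AB: "A \<subseteq> {1..n}" "B \<subseteq> {1..n}" "separated P A B"
  shows "indep_var (PiM A (\<lambda>_. S)) (obs_at A) (PiM B (\<lambda>_. S)) (obs_at B)"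
proof -
  define J where "J A = {C\<in>P. C \<inter> A \<noteq> {}}" for A
  define t where "t A z = (\<lambda>i\<in>A. z (cluster_of P i) i)" for A and z :: "nat set \<Rightarrow> nat \<Rightarrow> 'a"
  have cl: "cluster_of P i \<in> J A" "i \<in> cluster_of P i" if "i \<in> A" "A \<subseteq> {1..n}" for i A
  proof -
    from that Union_P obtain C where "C \<in> P" "i \<in> C" by blast
    with cluster_of_eq[OF part this] that show "cluster_of P i \<in> J A" "i \<in> cluster_of P i"
      by (auto simp: J_def)
  qed
  have t: "t A \<in> PiM (J A) (\<lambda>C. PiM C (\<lambda>_. S)) \<rightarrow>\<^sub>M PiM A (\<lambda>_. S)" if "A \<subseteq> {1..n}" for A
    unfolding t_def[abs_def]
  proof (rule measurable_restrict)
    fix i assume "i \<in> A"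
    note * = cl[OF this that]
    have "(\<lambda>z. z (cluster_of P i)) \<in> PiM (J A) (\<lambda>C. PiM C (\<lambda>_. S)) \<rightarrow>\<^sub>M PiM (cluster_of P i) (\<lambda>_. S)"
      "(\<lambda>y. y i) \<in> PiM (cluster_of P i) (\<lambda>_. S) \<rightarrow>\<^sub>M S"
      using * by (auto intro: measurable_component_singleton)
    then show "(\<lambda>z. z (cluster_of P i) i) \<in> PiM (J A) (\<lambda>C. PiM C (\<lambda>_. S)) \<rightarrow>\<^sub>M S"
      by (rule measurable_compose)
  qed
  have eq: "t A \<circ> (\<lambda>\<omega>. \<lambda>C\<in>J A. \<lambda>i\<in>C. W i \<omega>) = obs_at A" if "A \<subseteq> {1..n}" for A
    using cl[OF _ that] by (auto simp: t_def obs_at_def fun_eq_iff)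
  have "indep_var (PiM (J A) (\<lambda>C. PiM C (\<lambda>_. S))) (\<lambda>\<omega>. \<lambda>C\<in>J A. \<lambda>i\<in>C. W i \<omega>)
      (PiM (J B) (\<lambda>C. PiM C (\<lambda>_. S))) (\<lambda>\<omega>. \<lambda>C\<in>J B. \<lambda>i\<in>C. W i \<omega>)"
    using AB indep unfolding independent_across_clusters_def
    by (intro indep_var_restrict) (auto simp: J_def separated_def)
  from indep_var_compose[OF this t[OF AB(1)] t[OF AB(2)]] show ?thesis
    by (simp only: eq AB)
qed

text \<open>Integrating out the observations of \<open>xs\<close> with those of \<open>ys\<close>
  fixed leaves a multiple of the mean of the generic kernel value, which is 0.\<close>

lemma uncorrelated_generic:
  assumes xs: "length xs = k" "cluster_generic P xs" and ys: "length ys = k" "set ys \<subseteq> {1..n}"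
    and sep: "separated P (set ys) (set xs)"
  shows "(LINT \<omega>|M. kernel_at \<phi> W xs \<omega> * kernel_at \<phi> W ys \<omega>) = 0"
proof -
  let ?K = "\<lambda>xs. kernel_at \<phi> (\<lambda>i z. z i) xs"
  have xs_le: "set xs \<subseteq> {1..n}" using xs Union_P by (simp add: cluster_generic_def)
  have [measurable]: "?K xs \<in> borel_measurable (PiM (set xs) (\<lambda>_. S))"
      "?K ys \<in> borel_measurable (PiM (set ys) (\<lambda>_. S))"
    using xs ys by (auto intro!: kernel_at_coordinates_measurable)
  have "integrable M (\<lambda>\<omega>. kernel_at \<phi> W xs \<omega> * kernel_at \<phi> W ys \<omega>)"
    using xs xs_le ys by (intro square_integrable_mult sq)
  then have int: "integrable M (\<lambda>\<omega>. (\<lambda>(z, b). ?K xs b * ?K ys z) (obs_at (set ys) \<omega>, obs_at (set xs) \<omega>))"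
    by (simp add: kernel_at_coordinates[OF order_refl])
  have "(LINT \<omega>|M. kernel_at \<phi> W xs \<omega> * kernel_at \<phi> W ys \<omega>)
    = (LINT \<omega>|M. (\<lambda>(z, b). ?K xs b * ?K ys z) (obs_at (set ys) \<omega>, obs_at (set xs) \<omega>))"
    by (simp add: kernel_at_coordinates[OF order_refl])
  also have "\<dots> = (LINT \<omega>|M. (LINT \<omega>'|M. (\<lambda>(z, b). ?K xs b * ?K ys z) (obs_at (set ys) \<omega>, obs_at (set xs) \<omega>')))"
    by (rule indep_var_integral(2)[OF indep_var_obs_at[OF ys(2) xs_le sep] _ int]) measurable
  also have "\<dots> = 0"
    using centred[OF xs] by (simp add: kernel_at_coordinates[OF order_refl])
  finally show ?thesis .
qed

lemma generic_completionsD: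
  assumes "xs \<in> generic_completions P k i"
  shows "length xs = k - 1" "length (i # xs) = k" "i \<in> {1..n}" "set xs \<subseteq> {1..n}" "i \<notin> set xs" "distinct xs"
    "separated P {i} (set xs)" "cluster_generic P (i # xs)"
proof -
  have len: "length xs = k - 1" and gen: "cluster_generic P (i # xs)"
    using assms by (auto simp: generic_completions_def)
  then have dist: "distinct (i # xs)" and sub: "set (i # xs) \<subseteq> {1..n}"
    unfolding cluster_generic_def Union_P by blast+
  show "length xs = k - 1" "cluster_generic P (i # xs)" by fact+
  show "length (i # xs) = k" using len k by simp
  show "i \<in> {1..n}" "set xs \<subseteq> {1..n}" using sub unfolding list.set by blast+
  show "i \<notin> set xs" "distinct xs" using dist by auto
  then have "\<forall>x\<in>set xs. x \<noteq> i" by blast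
  moreover have "\<not> (\<exists>C\<in>P. i \<in> C \<and> x \<in> C)" if x: "x \<in> set xs" "x \<noteq> i" for x
  proof -
    have "i \<in> set (i # xs)" "x \<in> set (i # xs)" using x by simp_all
    with gen x(2) show ?thesis unfolding cluster_generic_def by (metis (no_types))
  qed
  ultimately show "separated P {i} (set xs)"
    unfolding separated_def by blast
qed

lemma finite_generic_completions: "finite (generic_completions P k i)"
  by (rule finite_subset[OF _ finite_lists_of_length[of "{1..n}" "k - 1"]])
    (use generic_completionsD in blast)+

lemma partial_mean_measurable:
  assumes "xs \<in> generic_completions P k i"
  shows "partial_mean xs \<in> borel_measurable S"
proof -
  note D = generic_completionsD[OF assms]
  have [measurable]: "obs_at (set xs) \<in> M \<rightarrow>\<^sub>M PiM (set xs) (\<lambda>_. S)"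
      "split_kernel xs \<in> borel_measurable (S \<Otimes>\<^sub>M PiM (set xs) (\<lambda>_. S))"
    using D by (auto intro!: obs_at_measurable split_kernel_measurable)
  show ?thesis unfolding partial_mean_def by measurable
qed

lemma proj_measurable: "proj i \<in> borel_measurable S"
  unfolding proj_def by (intro borel_measurable_divide borel_measurable_sum partial_mean_measurable) auto

text \<open>A generic completion avoids the cluster of \<open>i\<close>, hence its observations are
  independent of \<open>W i\<close>, and conditioning on \<open>W i\<close> amounts to integrating
  them out.\<close>

lemma cond_exp_partial_mean:
  assumes "xs \<in> generic_completions P k i"
  shows "AE \<omega> in M. real_cond_exp M (vimage_algebra (space M) (W i) S) (kernel_at \<phi> W (i # xs)) \<omega>
    = partial_mean xs (W i \<omega>)"
proof -
  note D = generic_completionsD[OF assms]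
  have eq: "kernel_at \<phi> W (i # xs) = (\<lambda>\<omega>. split_kernel xs (W i \<omega>, obs_at (set xs) \<omega>))"
    using kernel_at_split[OF D(1)] by auto
  have "integrable M (kernel_at \<phi> W (i # xs))"
    using D by (intro square_integrable_imp_integrable sq) auto
  then show ?thesis
    unfolding partial_mean_def eq
    using D by (intro cond_exp_indep_var[OF indep_var_obs_at[of "{i}" "set xs"], of "\<lambda>z. z i"]
        split_kernel_measurable measurable_component_singleton) (auto simp: obs_at_def)
qed

lemma mean_projection_eq: "AE \<omega> in M. mean_projection M S \<phi> k P W i \<omega> = proj i (W i \<omega>)"
proof -
  have "AE \<omega> in M. \<forall>xs\<in>generic_completions P k i.
      real_cond_exp M (vimage_algebra (space M) (W i) S) (kernel_at \<phi> W (i # xs)) \<omega>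
      = partial_mean xs (W i \<omega>)"
    using cond_exp_partial_mean finite_generic_completions by (intro AE_finite_allI) auto
  then show ?thesis
    by eventually_elim (simp add: mean_projection_def proj_def)
qed

lemma partial_mean_obs_measurable:
  "xs \<in> generic_completions P k i \<Longrightarrow> (\<lambda>\<omega>. partial_mean xs (W i \<omega>)) \<in> borel_measurable M"
  using measurable_compose[OF obs partial_mean_measurable] generic_completionsD(3) by blast

text \<open>Applied with \<open>q\<close> the square, for second moments, and with
  \<open>q = excess_powr r K\<close>, for tails.\<close>

lemma partial_mean_convex:
  fixes q :: "real \<Rightarrow> real"
  assumes xs: "xs \<in> generic_completions P k i" and q: "convex_on UNIV q" "q \<in> borel_measurable borel"
    and int: "integrable M (\<lambda>\<omega>. q (kernel_at \<phi> W (i # xs) \<omega>))"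
  shows "integrable M (\<lambda>\<omega>. q (partial_mean xs (W i \<omega>)))"
    and "(\<integral>\<omega>. q (partial_mean xs (W i \<omega>)) \<partial>M) \<le> (\<integral>\<omega>. q (kernel_at \<phi> W (i # xs) \<omega>) \<partial>M)"
proof -
  note D = generic_completionsD[OF xs]
  have "integrable M (kernel_at \<phi> W (i # xs))"
    using D by (intro square_integrable_imp_integrable sq) auto
  note * = real_cond_exp_convex[OF obs[OF D(3)] this q int cond_exp_partial_mean[OF xs] partial_mean_obs_measurable[OF xs]]
  show "integrable M (\<lambda>\<omega>. q (partial_mean xs (W i \<omega>)))"
    "(\<integral>\<omega>. q (partial_mean xs (W i \<omega>)) \<partial>M) \<le> (\<integral>\<omega>. q (kernel_at \<phi> W (i # xs) \<omega>) \<partial>M)"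
    by (fact *)+
qed

lemma square_integrable_partial_mean:
  assumes "xs \<in> generic_completions P k i"
  shows "square_integrable M (\<lambda>\<omega>. partial_mean xs (W i \<omega>))"
    and "(\<integral>\<omega>. (partial_mean xs (W i \<omega>))\<^sup>2 \<partial>M) \<le> c"
proof -
  note D = generic_completionsD[OF assms]
  have set: "set (i # xs) \<subseteq> {1..n}" using D by auto
  have int: "integrable M (\<lambda>\<omega>. (kernel_at \<phi> W (i # xs) \<omega>)\<^sup>2)"
    using sq[OF D(2) set] by (simp add: square_integrable_def)
  note * = partial_mean_convex[OF assms convex_power2 _ int]
  show "square_integrable M (\<lambda>\<omega>. partial_mean xs (W i \<omega>))"
    using *(1) partial_mean_obs_measurable[OF assms] by (simp add: square_integrable_def)
  show "(\<integral>\<omega>. (partial_mean xs (W i \<omega>))\<^sup>2 \<partial>M) \<le> c"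
    using *(2) sq_le[OF D(2) set] by simp
qed

lemma square_integrable_proj:
  shows "square_integrable M (\<lambda>\<omega>. proj i (W i \<omega>))" and "(\<integral>\<omega>. (proj i (W i \<omega>))\<^sup>2 \<partial>M) \<le> c"
proof -
  let ?A = "generic_completions P k i"
  show "square_integrable M (\<lambda>\<omega>. proj i (W i \<omega>))"
    unfolding proj_def
    by (intro square_integrable_divide square_integrable_sum square_integrable_partial_mean)
  have "(\<integral>\<omega>. (proj i (W i \<omega>))\<^sup>2 \<partial>M) = (\<integral>\<omega>. (\<Sum>xs\<in>?A. partial_mean xs (W i \<omega>))\<^sup>2 \<partial>M) / (real (card ?A))\<^sup>2"
    by (simp add: proj_def power_divide)
  also have "\<dots> \<le> (real (card ?A))\<^sup>2 * c / (real (card ?A))\<^sup>2"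
    by (intro divide_right_mono integral_sum_square_le finite_generic_completions
        square_integrable_partial_mean) auto
  \<comment> \<open>Without generic completions the quotient is 0 by the convention for division,
    and the bound rests on \<open>c\<close> being nonnegative.\<close>
  also have "\<dots> \<le> c" using c_nonneg by simp
  finally show "(\<integral>\<omega>. (proj i (W i \<omega>))\<^sup>2 \<partial>M) \<le> c" .
qed

text \<open>With all observations in \<open>J\<close> fixed, \<open>W i\<close> and \<open>G\<close>
  are fixed as well, so integrating out the completion gives 0. As \<open>J\<close> contains
  \<open>i\<close>, the function \<open>G\<close> may depend on the shared observation
  \<open>W i\<close>.\<close>

lemma uncorrelated_centred_completion:
  assumes xs: "xs \<in> generic_completions P k i" and J: "J \<subseteq> {1..n}" "i \<in> J" "separated P J (set xs)"
    and G: "G \<in> borel_measurable (PiM J (\<lambda>_. S))"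
    and sqG: "square_integrable M (\<lambda>\<omega>. G (obs_at J \<omega>))"
  shows "(\<integral>\<omega>. (kernel_at \<phi> W (i # xs) \<omega> - partial_mean xs (W i \<omega>)) * G (obs_at J \<omega>) \<partial>M) = 0"
proof -
  note D = generic_completionsD[OF xs]
  have set: "set (i # xs) \<subseteq> {1..n}" using D by auto
  have Wi: "W i \<omega> = obs_at J \<omega> i" for \<omega> using J by (simp add: obs_at_def)
  have eq: "kernel_at \<phi> W (i # xs) \<omega> - partial_mean xs (W i \<omega>)
    = split_kernel xs (obs_at J \<omega> i, obs_at (set xs) \<omega>)
      - (\<integral>\<omega>'. split_kernel xs (obs_at J \<omega> i, obs_at (set xs) \<omega>') \<partial>M)" for \<omega>
    unfolding kernel_at_split[OF D(1)] partial_mean_def Wi ..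
  have "integrable M (\<lambda>\<omega>. (kernel_at \<phi> W (i # xs) \<omega> - partial_mean xs (W i \<omega>)) * G (obs_at J \<omega>))"
    using xs D set sqG
    by (intro square_integrable_mult square_integrable_diff sq square_integrable_partial_mean) auto
  then show ?thesis
    unfolding eq using J D G
    by (intro indep_var_integral_centred[OF indep_var_obs_at, where S=S] split_kernel_measurable
        measurable_component_singleton) auto
qed

end

section \<open>Error of the estimated projections\<close>

lemma three_term_square: "(a + b - c)\<^sup>2 \<le> 3 * (a\<^sup>2 + b\<^sup>2 + c\<^sup>2)" for a b c :: real
proof -
  have "3 * (a\<^sup>2 + b\<^sup>2 + c\<^sup>2) - (a + b - c)\<^sup>2 = (a - b)\<^sup>2 + (a + c)\<^sup>2 + (b + c)\<^sup>2"
    by (simp add: power2_eq_square algebra_simps)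
  moreover have "0 \<le> (a - b)\<^sup>2 + (a + c)\<^sup>2 + (b + c)\<^sup>2" by simp
  ultimately show ?thesis by linarith
qed

lemma integral_diff_square_le:
  assumes "square_integrable M f" "square_integrable M g"
  shows "(LINT x|M. (f x - g x)\<^sup>2) \<le> 2 * (LINT x|M. (f x)\<^sup>2) + 2 * (LINT x|M. (g x)\<^sup>2)"
proof -
  have *: "(a - b)\<^sup>2 \<le> 2 * a\<^sup>2 + 2 * b\<^sup>2" for a b :: real
    using sum_squares_bound[of a "-b"] by (simp add: power2_diff)
  have "(LINT x|M. (f x - g x)\<^sup>2) \<le> (LINT x|M. 2 * (f x)\<^sup>2 + 2 * (g x)\<^sup>2)"
    using assms square_integrable_diff[OF assms] *
    by (intro integral_mono) (auto simp: square_integrable_def)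
  also have "\<dots> = 2 * (LINT x|M. (f x)\<^sup>2) + 2 * (LINT x|M. (g x)\<^sup>2)"
    using assms by (simp add: square_integrable_def)
  finally show ?thesis .
qed

context clustered_kernel
begin

lemma finite_P: "finite P" and finite_cluster: "C \<in> P \<Longrightarrow> finite C" and cluster_subset: "C \<in> P \<Longrightarrow> C \<subseteq> {1..n}"
proof -
  show "finite P" using Union_P by (metis finite_UnionD finite_atLeastAtMost)
  show sub: "C \<subseteq> {1..n}" if "C \<in> P" for C using that Union_P by blast
  show "finite C" if "C \<in> P" for C using sub[OF that] finite_subset by blast
qed

lemma square_integrable_U_stat: "square_integrable M (U_stat \<phi> k n W)"
proof -
  have "square_integrable M (\<lambda>\<omega>. U_stat \<phi> k n W \<omega>)"
    unfolding U_stat_def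
    by (intro square_integrable_divide square_integrable_sum sq) (auto simp: distinct_tuples_def)
  then show ?thesis .
qed

lemma card_separated_tuples:
  assumes "A \<subseteq> {1..n}" "length xs \<le> k" "j \<le> k"
  shows "card {ys\<in>distinct_tuples j A. \<not> separated P (set ys) (set xs)} \<le> k * k * m * n ^ (j - 1)"
proof -
  have "card {ys\<in>distinct_tuples j A. \<not> separated P (set ys) (set xs)}
      \<le> card {ys. length ys = j \<and> set ys \<subseteq> {1..n} \<and> \<not> separated P (set xs) (set ys)}"
    using assms by (intro card_mono finite_subset[OF _ finite_lists_of_length[of "{1..n}" j]])
      (auto simp: distinct_tuples_def separated_def)
  also have "\<dots> \<le> card (set xs) * j * m * n ^ (j - 1)"
    by (rule card_not_separated[OF part max_card]) auto
  also have "\<dots> \<le> k * k * m * n ^ (j - 1)"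
    using assms card_length[of xs] by (intro mult_le_mono) auto
  finally show ?thesis .
qed

text \<open>The factor 3 adds 2 for non-generic tuples (from \<open>k + 1 \<le> 2 * k\<close>) and 1
  for tuples meeting a cluster of a given one; \<open>2 ^ k\<close> comes from bounding the number
  of tuples below by \<open>(n / 2) ^ k\<close>.\<close>

lemma U_stat_second_moment:
  assumes n2k: "2 * k \<le> n"
  shows "(\<integral>\<omega>. (U_stat \<phi> k n W \<omega>)\<^sup>2 \<partial>M) \<le> 3 * c * (real k)\<^sup>2 * 2 ^ k * real m / real n"
proof -
  define D where "D = distinct_tuples k {1..n}"
  define N where "N = {xs\<in>D. \<not> cluster_generic P xs}"
  let ?q = "3 * (real k)\<^sup>2 * real m * real n ^ (k - 1)"
  have D: "length xs = k" "set xs \<subseteq> {1..n}" "distinct xs" if "xs \<in> D" for xs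
    using that by (auto simp: D_def distinct_tuples_def)
  have finD: "finite D" by (simp add: D_def finite_distinct_tuples)
  have cardD: "real (card D) = falling_fact n k" by (simp add: D_def card_distinct_tuples)
  have lower: "(real n / 2) ^ k \<le> falling_fact n k"
    using n2k by (intro falling_fact_ge) auto
  have pos: "0 < (real n / 2) ^ k" using n by simp
  have "card N \<le> card {xs. length xs = k \<and> set xs \<subseteq> {1..n} \<and> distinct ([] @ xs) \<and> \<not> cluster_generic P ([] @ xs)}"
    using D by (intro card_mono finite_subset[OF _ finite_lists_of_length[of "{1..n}" k]]) (auto simp: N_def)
  also have "\<dots> \<le> (k + 1) * k * m * n ^ (k - 1)"
    by (rule card_not_generic[OF part max_card]) auto
  also have "\<dots> \<le> (2 * k) * k * m * n ^ (k - 1)"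
    using k by (intro mult_le_mono) auto
  finally have "real (card N) \<le> real ((2 * k) * k * m * n ^ (k - 1))" by (rule of_nat_mono)
  then have cardN: "real (card N) \<le> 2 * (real k)\<^sup>2 * real m * real n ^ (k - 1)"
    by (simp add: power2_eq_square)
  have cardR: "real (card {ys\<in>D. \<not> separated P (set ys) (set xs)}) \<le> (real k)\<^sup>2 * real m * real n ^ (k - 1)" if "xs \<in> D" for xs
    using of_nat_mono[where ?'a=real, OF card_separated_tuples[of "{1..n}" xs k]] D[OF that] unfolding D_def[symmetric]
    by (simp add: power2_eq_square)
  have "(\<integral>\<omega>. (\<Sum>xs\<in>D. kernel_at \<phi> W xs \<omega>)\<^sup>2 \<partial>M)
    \<le> c * real (card D) * (2 * (real k)\<^sup>2 * real m * real n ^ (k - 1) + (real k)\<^sup>2 * real m * real n ^ (k - 1))"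
  proof (rule integral_sum_square_le_uncorrelated[OF finD _ _ c_nonneg, where N=N and R="\<lambda>xs ys. \<not> separated P (set ys) (set xs)"])
    fix xs ys assume "xs \<in> D - N" "ys \<in> D" "\<not> \<not> separated P (set ys) (set xs)"
    then show "(\<integral>\<omega>. kernel_at \<phi> W xs \<omega> * kernel_at \<phi> W ys \<omega> \<partial>M) = 0"
      using D by (intro uncorrelated_generic) (auto simp: N_def)
  qed (use D cardN cardR sq sq_le in \<open>auto simp: N_def\<close>)
  also have "\<dots> = c * falling_fact n k * ?q" by (simp add: cardD algebra_simps)
  finally have "(\<integral>\<omega>. (U_stat \<phi> k n W \<omega>)\<^sup>2 \<partial>M) \<le> c * falling_fact n k * ?q / (falling_fact n k)\<^sup>2"
    unfolding U_stat_def D_def by (simp add: power_divide divide_right_mono)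
  also have "\<dots> = c * ?q / falling_fact n k"
    using lower pos by (simp add: power2_eq_square)
  also have "\<dots> \<le> c * ?q / (real n / 2) ^ k"
    using lower pos c_nonneg by (intro divide_left_mono) auto
  also have "real n ^ k = real n * real n ^ (k - 1)"
    using k by (simp add: power_eq_if)
  then have "c * ?q / (real n / 2) ^ k = 3 * c * (real k)\<^sup>2 * 2 ^ k * real m / real n"
    using n by (simp add: power_divide field_simps)
  finally show ?thesis .
qed

text \<open>The conditional means are subtracted only for generic completions, so that \<open>Y xs\<close> is uncorrelated
  with \<open>Y ys\<close> as soon as \<open>xs\<close> is generic and shares no cluster with \<open>ys\<close>, whether or not \<open>ys\<close> is generic.\<close>

lemma est_projection_decomposition:
  fixes i
  defines "D \<equiv> distinct_tuples (k - 1) ({1..n} - {i})"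
  defines "A \<equiv> generic_completions P k i"
  defines "Y \<equiv> \<lambda>xs \<omega>. kernel_at \<phi> W (i # xs) \<omega> - (if xs \<in> A then partial_mean xs (W i \<omega>) else 0)"
  assumes i: "i \<in> {1..n}" and n2k: "2 * k \<le> n"
  shows "est_projection \<phi> k n W i \<omega> - proj i (W i \<omega>)
    = (\<Sum>xs\<in>D. Y xs \<omega>) / real (card D) + (real (card A) / real (card D) - 1) * proj i (W i \<omega>) - U_stat \<phi> k n W \<omega>"
    and "A \<subseteq> D" and "finite D" and "real (card D) = falling_fact (n - 1) (k - 1)"
proof -
  show finD: "finite D" by (simp add: D_def finite_distinct_tuples)
  show cardD: "real (card D) = falling_fact (n - 1) (k - 1)"
    using i by (simp add: D_def card_distinct_tuples)
  show "A \<subseteq> D"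
  proof
    fix xs assume "xs \<in> A"
    from generic_completionsD[OF this[unfolded A_def]] show "xs \<in> D"
      by (auto simp: D_def distinct_tuples_def)
  qed
  then have "(\<Sum>xs\<in>D. Y xs \<omega>) = (\<Sum>xs\<in>D. kernel_at \<phi> W (i # xs) \<omega>) - (\<Sum>xs\<in>A. partial_mean xs (W i \<omega>))"
    unfolding Y_def using finD by (simp add: sum_subtractf sum.If_cases Int_absorb1)
  \<comment> \<open>If \<open>A\<close> is empty then \<open>proj\<close> is 0 by the convention for
    division, and both sides vanish.\<close>
  moreover have "(\<Sum>xs\<in>A. partial_mean xs (W i \<omega>)) = real (card A) * proj i (W i \<omega>)"
    using finite_generic_completions[of i] by (cases "A = {}") (auto simp: proj_def A_def)
  ultimately have *: "(\<Sum>xs\<in>D. kernel_at \<phi> W (i # xs) \<omega>) = (\<Sum>xs\<in>D. Y xs \<omega>) + real (card A) * proj i (W i \<omega>)"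
    by simp
  show "est_projection \<phi> k n W i \<omega> - proj i (W i \<omega>)
    = (\<Sum>xs\<in>D. Y xs \<omega>) / real (card D) + (real (card A) / real (card D) - 1) * proj i (W i \<omega>) - U_stat \<phi> k n W \<omega>"
    unfolding est_projection_def fixed_index_mean_def cardD D_def[symmetric] *
    by (simp add: add_divide_distrib left_diff_distrib)
qed

text \<open>The error splits into the average of the centred kernel values \<open>Y\<close>, a term
  for the different normalisations by \<open>card A\<close> and \<open>card D\<close>, and the
  U-statistic; each has second moment of order \<open>m / n\<close>.\<close>

lemma est_projection_second_moment:
  assumes i: "i \<in> {1..n}" and n2k: "2 * k \<le> n" and k2: "2 \<le> k"
  shows "square_integrable M (\<lambda>\<omega>. est_projection \<phi> k n W i \<omega> - proj i (W i \<omega>))"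
    and "(\<integral>\<omega>. (est_projection \<phi> k n W i \<omega> - proj i (W i \<omega>))\<^sup>2 \<partial>M) \<le> 24 * c * (real k)\<^sup>2 * 2 ^ k * real m / real n"
proof -
  define D where "D = distinct_tuples (k - 1) ({1..n} - {i})"
  define A where "A = generic_completions P k i"
  define Y where "Y = (\<lambda>xs \<omega>. kernel_at \<phi> W (i # xs) \<omega> - (if xs \<in> A then partial_mean xs (W i \<omega>) else 0))"
  define d where "d = real (card D)"
  define a where "a = real (card A) / d - 1"
  \<comment> \<open>\<open>q\<close> bounds both the number of non-generic completions and, for each
    completion, the number of those sharing a cluster with it. The power of \<open>n\<close> is one
    below the number \<open>k - 1\<close> of free entries.\<close>
  define q where "q = (real k)\<^sup>2 * real m * real n ^ (k - 2)"
  note dec = est_projection_decomposition[OF i n2k, folded D_def, folded A_def]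
  have D: "length (i # xs) = k" "length xs = k - 1" "set (i # xs) \<subseteq> {1..n}" "distinct (i # xs)" if "xs \<in> D" for xs
    using that k i by (auto simp: D_def distinct_tuples_def)
  have finA: "finite A" unfolding A_def by (rule finite_generic_completions)
  have lower: "(real n / 2) ^ (k - 1) \<le> d"
    unfolding d_def dec(4) using n2k k n by (intro falling_fact_ge) (auto simp: of_nat_diff)
  have pos: "0 < (real n / 2) ^ (k - 1)" using n by simp
  have dpos: "0 < d" using lower pos by linarith
  have q0: "0 \<le> q" by (simp add: q_def)
  have "real n ^ (k - 1) = real n * real n ^ (k - 2)"
    using k2 by (metis Suc_diff_le Suc_1 diff_Suc_Suc numeral_2_eq_2 power_Suc)
  then have q_le: "q / d \<le> (real k)\<^sup>2 * 2 ^ k * real m / real n / 2"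
  proof -
    have "q / d \<le> q / (real n / 2) ^ (k - 1)"
      using lower pos dpos q0 by (intro divide_left_mono) auto
    also have "\<dots> = (real k)\<^sup>2 * 2 ^ (k - 1) * real m / real n"
      using \<open>real n ^ (k - 1) = _\<close> n by (simp add: q_def power_divide field_simps)
    also have "(2::real) ^ (k - 1) = 2 ^ k / 2"
      using k by (simp add: power_eq_if)
    finally show ?thesis by simp
  qed
  have "card (D - A) \<le> card {xs. length xs = k - 1 \<and> set xs \<subseteq> {1..n} \<and> distinct ([i] @ xs) \<and> \<not> cluster_generic P ([i] @ xs)}"
    using D by (intro card_mono finite_subset[OF _ finite_lists_of_length[of "{1..n}" "k - 1"]])
      (auto simp: A_def generic_completions_def)
  also have "\<dots> \<le> (k - 1 + 1) * (k - 1) * m * n ^ (k - 1 - 1)"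
    using i by (intro card_not_generic[OF part max_card]) auto
  also have "\<dots> \<le> k * k * m * n ^ (k - 2)"
    using k2 by (intro mult_le_mono) (auto simp: numeral_2_eq_2)
  finally have "real (card (D - A)) \<le> real (k * k * m * n ^ (k - 2))" by (rule of_nat_mono)
  then have cardN: "real (card (D - A)) \<le> q"
    by (simp add: q_def power2_eq_square)
  have cardR: "real (card {ys\<in>D. \<not> separated P (set ys) (set xs)}) \<le> q" if "xs \<in> D" for xs
    using of_nat_mono[where ?'a=real, OF card_separated_tuples[of "{1..n} - {i}" xs "k - 1"]] D[OF that] k2 unfolding D_def[symmetric]
    by (simp add: q_def power2_eq_square numeral_2_eq_2)
  have sqI: "square_integrable M (\<lambda>\<omega>. if xs \<in> A then partial_mean xs (W i \<omega>) else 0)" for xs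
    using square_integrable_partial_mean(1)[of xs i]
    by (cases "xs \<in> A") (simp_all add: A_def square_integrable_const)
  have sqY: "square_integrable M (Y xs)" if "xs \<in> D" for xs
    unfolding Y_def using D[OF that] by (intro square_integrable_diff sq sqI) auto
  have Y_le: "(\<integral>\<omega>. (Y xs \<omega>)\<^sup>2 \<partial>M) \<le> 4 * c" if "xs \<in> D" for xs
  proof -
    have "(\<integral>\<omega>. (Y xs \<omega>)\<^sup>2 \<partial>M) \<le> 2 * (\<integral>\<omega>. (kernel_at \<phi> W (i # xs) \<omega>)\<^sup>2 \<partial>M)
        + 2 * (\<integral>\<omega>. (if xs \<in> A then partial_mean xs (W i \<omega>) else 0)\<^sup>2 \<partial>M)"
      unfolding Y_def using D[OF that] by (intro integral_diff_square_le sq sqI) auto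
    also have "(\<integral>\<omega>. (if xs \<in> A then partial_mean xs (W i \<omega>) else 0)\<^sup>2 \<partial>M) \<le> c"
      using square_integrable_partial_mean(2)[of xs i] c_nonneg by (cases "xs \<in> A") (simp_all add: A_def)
    also have "2 * (\<integral>\<omega>. (kernel_at \<phi> W (i # xs) \<omega>)\<^sup>2 \<partial>M) + 2 * c \<le> 2 * c + 2 * c"
      using sq_le[OF D(1) D(3)] that by simp
    finally show ?thesis by simp
  qed
  have sumY: "(\<integral>\<omega>. (\<Sum>xs\<in>D. Y xs \<omega>)\<^sup>2 \<partial>M) \<le> (4 * c) * real (card D) * (q + q)"
  proof (rule integral_sum_square_le_uncorrelated[OF dec(3) sqY Y_le _ _ cardN cardR])
    fix xs ys assume xs: "xs \<in> D - (D - A)" and ys: "ys \<in> D" and "\<not> \<not> separated P (set ys) (set xs)"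
    \<comment> \<open>As \<open>xs\<close> is generic, the common index \<open>i\<close> shares no
      cluster with it; separation from \<open>ys\<close> therefore extends to
      \<open>i # ys\<close>.\<close>
    then have xsA: "xs \<in> A" and sep: "separated P (set (i # ys)) (set xs)"
      using generic_completionsD(7)[of xs i] by (auto simp: A_def separated_iff_cluster_of)
    let ?J = "set (i # ys)"
    \<comment> \<open>\<open>Y ys\<close> as a function of the observations in \<open>?J\<close>,
      which include the shared one \<open>W i\<close>.\<close>
    define G where "G z = kernel_at \<phi> (\<lambda>i z. z i) (i # ys) z - (if ys \<in> A then partial_mean ys (z i) else 0)"
      for z :: "nat \<Rightarrow> 'a"
    have G_eq: "G (obs_at ?J \<omega>) = Y ys \<omega>" for \<omega>
      unfolding G_def Y_def kernel_at_coordinates[of "i # ys" ?J, OF order_refl]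
      by (simp add: obs_at_def)
    have "(\<lambda>z. partial_mean ys (z i)) \<in> borel_measurable (PiM ?J (\<lambda>_. S))" if "ys \<in> A"
    proof -
      have "(\<lambda>z. z i) \<in> PiM ?J (\<lambda>_. S) \<rightarrow>\<^sub>M S" by (intro measurable_component_singleton) simp
      from measurable_compose[OF this partial_mean_measurable[OF that[unfolded A_def]]] show ?thesis .
    qed
    then have "(\<lambda>z. if ys \<in> A then partial_mean ys (z i) else 0) \<in> borel_measurable (PiM ?J (\<lambda>_. S))"
      by (cases "ys \<in> A") simp_all
    then have G: "G \<in> borel_measurable (PiM ?J (\<lambda>_. S))"
      unfolding G_def using D[OF ys] by (intro borel_measurable_diff kernel_at_coordinates_measurable) auto
    have "(\<integral>\<omega>. Y xs \<omega> * Y ys \<omega> \<partial>M)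
      = (\<integral>\<omega>. (kernel_at \<phi> W (i # xs) \<omega> - partial_mean xs (W i \<omega>)) * G (obs_at ?J \<omega>) \<partial>M)"
      using xsA by (simp only: G_eq) (simp add: Y_def)
    also have "\<dots> = 0"
      using D[OF ys] sep xsA sqY[OF ys]
      by (intro uncorrelated_centred_completion G) (auto simp: A_def G_eq[abs_def] G_eq simp del: list.set intro: list.set_intros(1))
    finally show "(\<integral>\<omega>. Y xs \<omega> * Y ys \<omega> \<partial>M) = 0" .
  qed (use c_nonneg in auto)
  let ?Z = "\<lambda>\<omega>. (\<Sum>xs\<in>D. Y xs \<omega>) / d"
  let ?V = "\<lambda>\<omega>. a * proj i (W i \<omega>)"
  let ?U = "U_stat \<phi> k n W"
  have sqZ: "square_integrable M ?Z" and sqV: "square_integrable M ?V"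
    by (intro square_integrable_divide square_integrable_sum sqY square_integrable_cmult
        square_integrable_proj | assumption)+
  have eq: "est_projection \<phi> k n W i \<omega> - proj i (W i \<omega>) = ?Z \<omega> + ?V \<omega> - ?U \<omega>" for \<omega>
    unfolding dec(1) a_def d_def Y_def ..
  have "square_integrable M (\<lambda>\<omega>. ?Z \<omega> - (-1) * ?V \<omega> - ?U \<omega>)"
    by (intro square_integrable_diff sqZ square_integrable_cmult[OF sqV] square_integrable_U_stat)
  then show int: "square_integrable M (\<lambda>\<omega>. est_projection \<phi> k n W i \<omega> - proj i (W i \<omega>))"
    unfolding eq by simp
  have Z_le: "(\<integral>\<omega>. (?Z \<omega>)\<^sup>2 \<partial>M) \<le> 8 * c * (q / d)"
  proof -
    have "(\<integral>\<omega>. (?Z \<omega>)\<^sup>2 \<partial>M) = (\<integral>\<omega>. (\<Sum>xs\<in>D. Y xs \<omega>)\<^sup>2 \<partial>M) / d\<^sup>2"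
      by (simp add: power_divide)
    also have "\<dots> \<le> (4 * c) * d * (q + q) / d\<^sup>2"
      using sumY by (intro divide_right_mono) (auto simp: d_def)
    also have "\<dots> = 8 * c * (q / d)" using dpos by (simp add: power2_eq_square)
    finally show ?thesis .
  qed
  have V_le: "(\<integral>\<omega>. (?V \<omega>)\<^sup>2 \<partial>M) \<le> c * (q / d)"
  proof -
    \<comment> \<open>\<open>- a\<close> is the proportion of non-generic completions, which lies
      between 0 and 1, so its square is at most itself.\<close>
    have "real (card (D - A)) = d - real (card A)"
      using dec(2,3) finA by (simp add: d_def card_Diff_subset card_mono of_nat_diff)
    then have a_eq: "a = - (real (card (D - A)) / d)"
      using dpos by (simp add: a_def diff_divide_distrib)
    have "real (card (D - A)) / d \<le> 1"
      using dpos dec(2,3) by (simp add: d_def card_mono)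
    then have "a\<^sup>2 \<le> real (card (D - A)) / d"
      using dpos mult_left_le[of "real (card (D - A)) / d" "real (card (D - A)) / d"]
      unfolding a_eq power2_minus by (simp only: power2_eq_square) simp
    also have "\<dots> \<le> q / d" using cardN dpos by (intro divide_right_mono) auto
    finally have "a\<^sup>2 * (\<integral>\<omega>. (proj i (W i \<omega>))\<^sup>2 \<partial>M) \<le> (q / d) * c"
      using square_integrable_proj(2)[of i] q0 dpos by (intro mult_mono) auto
    then show ?thesis by (simp add: power_mult_distrib mult.commute)
  qed
  have "(\<integral>\<omega>. (est_projection \<phi> k n W i \<omega> - proj i (W i \<omega>))\<^sup>2 \<partial>M)
    \<le> (\<integral>\<omega>. 3 * ((?Z \<omega>)\<^sup>2 + (?V \<omega>)\<^sup>2 + (?U \<omega>)\<^sup>2) \<partial>M)"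
  proof (rule integral_mono)
    show "integrable M (\<lambda>\<omega>. (est_projection \<phi> k n W i \<omega> - proj i (W i \<omega>))\<^sup>2)"
      using int by (simp add: square_integrable_def)
    show "integrable M (\<lambda>\<omega>. 3 * ((?Z \<omega>)\<^sup>2 + (?V \<omega>)\<^sup>2 + (?U \<omega>)\<^sup>2))"
      using sqZ sqV square_integrable_U_stat
      by (intro integrable_mult_right Bochner_Integration.integrable_add) (auto simp: square_integrable_def)
  qed (simp only: eq three_term_square)
  also have "\<dots> = 3 * ((\<integral>\<omega>. (?Z \<omega>)\<^sup>2 \<partial>M) + (\<integral>\<omega>. (?V \<omega>)\<^sup>2 \<partial>M) + (\<integral>\<omega>. (?U \<omega>)\<^sup>2 \<partial>M))"
  proof -
    have "integrable M (\<lambda>\<omega>. (?Z \<omega>)\<^sup>2)" "integrable M (\<lambda>\<omega>. (?V \<omega>)\<^sup>2)" "integrable M (\<lambda>\<omega>. (?U \<omega>)\<^sup>2)"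
      using sqZ sqV square_integrable_U_stat unfolding square_integrable_def by blast+
    then show ?thesis by (simp only: integral_mult_right_zero Bochner_Integration.integral_add Bochner_Integration.integrable_add)
  qed
  also have "\<dots> \<le> 3 * (8 * c * (q / d) + c * (q / d) + 3 * c * (real k)\<^sup>2 * 2 ^ k * real m / real n)"
    by (intro mult_left_mono add_mono Z_le V_le U_stat_second_moment n2k) auto
  also have "\<dots> = 27 * c * (q / d) + 9 * c * ((real k)\<^sup>2 * 2 ^ k * real m / real n)"
    by (simp add: algebra_simps)
  also have "\<dots> \<le> 27 * c * ((real k)\<^sup>2 * 2 ^ k * real m / real n / 2) + 9 * c * ((real k)\<^sup>2 * 2 ^ k * real m / real n)"
    using q_le c_nonneg by (intro add_mono mult_left_mono) auto
  \<comment> \<open>Three times 8 + 1 gives 27, halved by \<open>q_le\<close>; three times the 3 of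
    the U-statistic gives 9; the sum 27/2 + 9 = 45/2 is rounded up to 24.\<close>
  also have "\<dots> = 45 / 2 * (c * ((real k)\<^sup>2 * 2 ^ k * real m / real n))"
    by (simp add: algebra_simps)
  also have "\<dots> \<le> 24 * (c * ((real k)\<^sup>2 * 2 ^ k * real m / real n))"
    using c_nonneg by (intro mult_right_mono) auto
  finally show "(\<integral>\<omega>. (est_projection \<phi> k n W i \<omega> - proj i (W i \<omega>))\<^sup>2 \<partial>M) \<le> 24 * c * (real k)\<^sup>2 * 2 ^ k * real m / real n"
    by (simp add: mult.assoc)
qed

text \<open>A cluster \<open>C\<close> costs at most \<open>card C * m\<close> times the error bound
  of one index, which is of order \<open>m / n\<close>; the sizes add up to \<open>n\<close>, which
  cancels the denominator.\<close>

lemma sum_cluster_error_le: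
  assumes n2k: "2 * k \<le> n" and k2: "2 \<le> k"
  shows "(\<Sum>C\<in>P. \<integral>\<omega>. (\<Sum>i\<in>C. est_projection \<phi> k n W i \<omega> - proj i (W i \<omega>))\<^sup>2 \<partial>M)
    \<le> 24 * c * (real k)\<^sup>2 * 2 ^ k * (real m)\<^sup>2"
proof -
  let ?e = "24 * c * (real k)\<^sup>2 * 2 ^ k * real m / real n"
  have e0: "0 \<le> ?e" using c_nonneg by simp
  have "(\<Sum>C\<in>P. \<integral>\<omega>. (\<Sum>i\<in>C. est_projection \<phi> k n W i \<omega> - proj i (W i \<omega>))\<^sup>2 \<partial>M)
      \<le> (\<Sum>C\<in>P. real (card C) * (real m * ?e))"
  proof (rule sum_mono)
    fix C assume C: "C \<in> P"
    have "(\<integral>\<omega>. (\<Sum>i\<in>C. est_projection \<phi> k n W i \<omega> - proj i (W i \<omega>))\<^sup>2 \<partial>M) \<le> (real (card C))\<^sup>2 * ?e"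
      using cluster_subset[OF C] n2k k2
      by (intro integral_sum_square_le finite_cluster[OF C] est_projection_second_moment) auto
    also have "\<dots> = real (card C) * (real (card C) * ?e)" by (simp add: power2_eq_square)
    also have "\<dots> \<le> real (card C) * (real m * ?e)"
      using max_card[OF C] e0 by (intro mult_left_mono mult_right_mono) auto
    finally show "(\<integral>\<omega>. (\<Sum>i\<in>C. est_projection \<phi> k n W i \<omega> - proj i (W i \<omega>))\<^sup>2 \<partial>M) \<le> real (card C) * (real m * ?e)" .
  qed
  also have "\<dots> = real (\<Sum>C\<in>P. card C) * (real m * ?e)"
    unfolding of_nat_sum sum_distrib_right ..
  also have "(\<Sum>C\<in>P. card C) = n"
    using part card_Union_disjoint[of P] finite_cluster Union_P by (auto simp: partition_on_def disjoint_def pairwise_def)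
  finally show ?thesis using n by (simp add: power2_eq_square algebra_simps)
qed

end

section \<open>Law of large numbers for the cluster sums\<close>

text \<open>A convex replacement for \<open>|x| powr r\<close> restricted to \<open>|x| > K\<close>: Jensen's inequality carries its
  bound from the kernel to conditional expectations and averages, which a truncated power does not allow.\<close>

definition excess_powr :: "real \<Rightarrow> real \<Rightarrow> real \<Rightarrow> real" where
  "excess_powr r K x = max 0 (\<bar>x\<bar> - K) powr r"

lemma excess_powr_nonneg: "0 \<le> excess_powr r K x"
  by (simp add: excess_powr_def)

lemma excess_powr_measurable: "excess_powr r K \<in> borel_measurable borel"
  unfolding excess_powr_def[abs_def] by measurable

text \<open>The excess is compared with plain powers: from above with the tail beyond
  \<open>K\<close> here, from below with values beyond \<open>2 * K\<close> in the next
  lemma.\<close>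

lemma excess_powr_le:
  assumes "0 \<le> r" "0 \<le> K"
  shows "excess_powr r K x \<le> \<bar>x\<bar> powr r * indicator {x. K < \<bar>x\<bar>} x"
proof (cases "K < \<bar>x\<bar>")
  case True
  then show ?thesis using assms by (auto simp: excess_powr_def intro!: powr_mono2)
qed (simp add: excess_powr_def)

text \<open>Beyond \<open>2 * K\<close> at least half of \<open>\<bar>x\<bar>\<close> remains after
  subtracting \<open>K\<close>.\<close>

lemma powr_le_excess_powr:
  assumes "0 \<le> r" "0 \<le> K" "2 * K \<le> \<bar>x\<bar>"
  shows "\<bar>x\<bar> powr r \<le> 2 powr r * excess_powr r K x"
proof -
  have "(\<bar>x\<bar> / 2) powr r \<le> excess_powr r K x"
    unfolding excess_powr_def using assms by (intro powr_mono2) auto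
  then show ?thesis by (simp add: powr_divide field_simps)
qed

text \<open>A zero argument is treated apart: the claim then reduces to
  \<open>s powr r \<le> s\<close> for \<open>0 < s < 1\<close>.\<close>

lemma powr_convex_combination:
  fixes a b t r :: real
  assumes "0 \<le> a" "0 \<le> b" "0 < t" "t < 1" "1 \<le> r"
  shows "((1 - t) * a + t * b) powr r \<le> (1 - t) * a powr r + t * b powr r"
proof (cases "a = 0 \<or> b = 0")
  case True
  have le: "(s * y) powr r \<le> s * y powr r" if "0 < s" "s < 1" "0 \<le> y" for s y
  proof -
    have "s powr r \<le> s powr 1" using that assms by (intro powr_mono') auto
    then show ?thesis using that by (simp add: powr_mult mult_right_mono)
  qed
  from True show ?thesis
    using le[of t b] le[of "1 - t" a] assms by auto
next
  case False
  then show ?thesis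
    using convex_onD[OF powr_convex[OF assms(5)], of t a b] assms by auto
qed

text \<open>The positive part of the convex function \<open>\<bar>x\<bar> - K\<close>, followed by a
  power that is increasing and convex on the nonnegative reals.\<close>

lemma convex_excess_powr:
  assumes "1 \<le> r"
  shows "convex_on UNIV (excess_powr r K)"
proof (rule convex_onI)
  fix t x y :: real assume t: "0 < t" "t < 1"
  let ?e = "\<lambda>x. max 0 (\<bar>x\<bar> - K)"
  have "\<bar>(1 - t) * x + t * y\<bar> - K \<le> (1 - t) * (\<bar>x\<bar> - K) + t * (\<bar>y\<bar> - K)"
  proof -
    have "\<bar>(1 - t) * x\<bar> = (1 - t) * \<bar>x\<bar>" "\<bar>t * y\<bar> = t * \<bar>y\<bar>"
      using t by (simp_all add: abs_mult)
    moreover have "(1 - t) * (\<bar>x\<bar> - K) + t * (\<bar>y\<bar> - K) = (1 - t) * \<bar>x\<bar> + t * \<bar>y\<bar> - K"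
      by (simp add: algebra_simps)
    ultimately show ?thesis
      using abs_triangle_ineq[of "(1 - t) * x" "t * y"] by linarith
  qed
  also have "\<dots> \<le> (1 - t) * ?e x + t * ?e y"
    using t by (intro add_mono mult_left_mono) auto
  finally have "?e ((1 - t) * x + t * y) \<le> (1 - t) * ?e x + t * ?e y"
    using t by simp
  then have "excess_powr r K ((1 - t) * x + t * y) \<le> ((1 - t) * ?e x + t * ?e y) powr r"
    unfolding excess_powr_def using assms by (intro powr_mono2) auto
  also have "\<dots> \<le> (1 - t) * excess_powr r K x + t * excess_powr r K y"
    unfolding excess_powr_def using t assms by (intro powr_convex_combination) auto
  finally show "excess_powr r K ((1 - t) *\<^sub>R x + t *\<^sub>R y) \<le> (1 - t) * excess_powr r K x + t * excess_powr r K y"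
    by simp
qed simp

lemma convex_on_average:
  fixes q :: "real \<Rightarrow> real"
  assumes "finite I" "I \<noteq> {}" "convex_on UNIV q"
  shows "q ((\<Sum>i\<in>I. f i) / real (card I)) \<le> (\<Sum>i\<in>I. q (f i)) / real (card I)"
  using convex_on_sum[OF assms(1,2,3), of "\<lambda>_. 1 / real (card I)" f] assms
  by (simp add: sum_divide_distrib)

text \<open>Pointwise Jensen lets a common bound \<open>b\<close> pass from the members to their
  average, with no factor for their number.\<close>

lemma integral_convex_average_le:
  fixes q :: "real \<Rightarrow> real"
  assumes I: "finite I" "I \<noteq> {}" and q: "convex_on UNIV q" "q \<in> borel_measurable borel" "\<And>x. 0 \<le> q x"
    and f: "\<And>i. i \<in> I \<Longrightarrow> f i \<in> borel_measurable M" "\<And>i. i \<in> I \<Longrightarrow> integrable M (\<lambda>x. q (f i x))"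
      "\<And>i. i \<in> I \<Longrightarrow> (LINT x|M. q (f i x)) \<le> b"
  shows "integrable M (\<lambda>x. q ((\<Sum>i\<in>I. f i x) / real (card I)))"
    and "(LINT x|M. q ((\<Sum>i\<in>I. f i x) / real (card I))) \<le> b"
proof -
  have int: "integrable M (\<lambda>x. (\<Sum>i\<in>I. q (f i x)) / real (card I))"
    using f by (intro Bochner_Integration.integrable_divide Bochner_Integration.integrable_sum)
  have le: "q ((\<Sum>i\<in>I. f i x) / real (card I)) \<le> (\<Sum>i\<in>I. q (f i x)) / real (card I)" for x
    using I q by (intro convex_on_average)
  have meas: "(\<lambda>x. q ((\<Sum>i\<in>I. f i x) / real (card I))) \<in> borel_measurable M"
    using f q(2) by (intro measurable_compose[OF _ q(2)] borel_measurable_divide borel_measurable_sum) auto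
  show int': "integrable M (\<lambda>x. q ((\<Sum>i\<in>I. f i x) / real (card I)))"
    using le q(3) by (intro Bochner_Integration.integrable_bound[OF int meas]) (auto simp: abs_of_nonneg sum_nonneg)
  have "(LINT x|M. q ((\<Sum>i\<in>I. f i x) / real (card I))) \<le> (LINT x|M. (\<Sum>i\<in>I. q (f i x)) / real (card I))"
    using le by (intro integral_mono int int')
  also have "\<dots> = (\<Sum>i\<in>I. LINT x|M. q (f i x)) / real (card I)"
    using f by simp
  also have "\<dots> \<le> (\<Sum>i\<in>I. b) / real (card I)"
    using f by (intro divide_right_mono sum_mono) auto
  also have "\<dots> = b" using I by simp
  finally show "(LINT x|M. q ((\<Sum>i\<in>I. f i x) / real (card I))) \<le> b" .
qed

text \<open>The cross term in s^2 - t^2 = (s - t)^2 + 2 (s - t) t is split by the weighted AM-GM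
  inequality. The weight \<open>d\<close> is free: the multiple of t^2 can be made small, while the
  large factor falls on the error \<open>s - t\<close>.\<close>

lemma square_diff_le:
  fixes s t d :: real
  assumes "0 < d"
  shows "\<bar>s\<^sup>2 - t\<^sup>2\<bar> \<le> (1 + 1 / d) * (s - t)\<^sup>2 + d * t\<^sup>2"
proof -
  have "s\<^sup>2 - t\<^sup>2 = (s - t)\<^sup>2 + 2 * ((s - t) * t)" by (simp add: power2_eq_square algebra_simps)
  then have "\<bar>s\<^sup>2 - t\<^sup>2\<bar> \<le> (s - t)\<^sup>2 + 2 * \<bar>(s - t) * t\<bar>"
    using abs_triangle_ineq[of "(s - t)\<^sup>2" "2 * ((s - t) * t)"] by simp
  moreover have "2 * \<bar>(s - t) * t\<bar> \<le> (s - t)\<^sup>2 / d + d * t\<^sup>2"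
  proof -
    have "0 \<le> (\<bar>s - t\<bar> - d * \<bar>t\<bar>)\<^sup>2 / d" using assms by simp
    also have "\<dots> = (s - t)\<^sup>2 / d + d * t\<^sup>2 - 2 * \<bar>(s - t) * t\<bar>"
      using assms by (simp add: power2_diff power_mult_distrib abs_mult diff_divide_distrib add_divide_distrib power2_eq_square[of d])
    finally show ?thesis by simp
  qed
  ultimately show ?thesis by (simp add: distrib_right)
qed

lemma tail_powr_integrable:
  assumes X: "X \<in> borel_measurable M" and h: "0 \<le> h"
    and le: "(\<integral>\<^sup>+ \<omega>. ennreal (\<bar>X \<omega>\<bar> powr r) * indicator {\<omega>. \<bar>X \<omega>\<bar> > K} \<omega> \<partial>M) \<le> ennreal h"
  shows "integrable M (\<lambda>\<omega>. \<bar>X \<omega>\<bar> powr r * indicator {x. K < \<bar>x\<bar>} (X \<omega>))"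
    and "(LINT \<omega>|M. \<bar>X \<omega>\<bar> powr r * indicator {x. K < \<bar>x\<bar>} (X \<omega>)) \<le> h"
proof -
  let ?g = "\<lambda>\<omega>. \<bar>X \<omega>\<bar> powr r * indicator {x. K < \<bar>x\<bar>} (X \<omega>)"
  have meas: "?g \<in> borel_measurable M" using X by measurable
  have "(\<integral>\<^sup>+ \<omega>. ennreal (?g \<omega>) \<partial>M) = (\<integral>\<^sup>+ \<omega>. ennreal (\<bar>X \<omega>\<bar> powr r) * indicator {\<omega>. \<bar>X \<omega>\<bar> > K} \<omega> \<partial>M)"
    by (intro nn_integral_cong) (auto simp: indicator_def)
  with le have nn: "(\<integral>\<^sup>+ \<omega>. ennreal (?g \<omega>) \<partial>M) \<le> ennreal h" by simp
  show "integrable M ?g"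
    using nn by (intro integrableI_nonneg meas) (auto intro: le_less_trans)
  show "(LINT \<omega>|M. ?g \<omega>) \<le> h"
    using nn h by (subst integral_eq_nn_integral[OF meas]) (auto intro: enn2real_leI)
qed

text \<open>With \<open>K\<close> at least 1, squares are below \<open>r\<close>-th powers on the
  tail. This turns uniform integrability of the powers into a uniform second moment bound.\<close>

lemma power2_le_tail_powr:
  fixes x :: real
  assumes "1 \<le> K" "2 \<le> r"
  shows "x\<^sup>2 \<le> K\<^sup>2 + \<bar>x\<bar> powr r * indicator {x. K < \<bar>x\<bar>} x"
proof (cases "K < \<bar>x\<bar>")
  case True
  then have "x\<^sup>2 = \<bar>x\<bar> powr 2" using assms by simp
  also have "\<dots> \<le> \<bar>x\<bar> powr r" using True assms by (intro powr_mono) auto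
  finally show ?thesis using True by (simp add: add_increasing)
next
  case False
  then have "\<bar>x\<bar>\<^sup>2 \<le> K\<^sup>2" by (intro power_mono) auto
  with False show ?thesis by simp
qed

section \<open>A truncated law of large numbers in L^1\<close>

context prob_space
begin

lemma square_sum_uncorrelated:
  assumes "finite I" "\<And>i. i \<in> I \<Longrightarrow> square_integrable M (f i)"
    and "\<And>i j. \<lbrakk>i \<in> I; j \<in> I; i \<noteq> j\<rbrakk> \<Longrightarrow> (\<integral>x. f i x * f j x \<partial>M) = 0"
  shows "(\<integral>x. (\<Sum>i\<in>I. f i x)\<^sup>2 \<partial>M) = (\<Sum>i\<in>I. \<integral>x. (f i x)\<^sup>2 \<partial>M)"
proof -
  have "(\<integral>x. (\<Sum>i\<in>I. f i x)\<^sup>2 \<partial>M) = (\<Sum>i\<in>I. \<Sum>j\<in>I. \<integral>x. f i x * f j x \<partial>M)"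
    using assms by (simp add: power2_eq_square sum_product square_integrable_mult)
  also have "\<dots> = (\<Sum>i\<in>I. \<Sum>j\<in>I. if i = j then \<integral>x. (f i x)\<^sup>2 \<partial>M else 0)"
    using assms by (intro sum.cong) (auto simp: power2_eq_square)
  finally show ?thesis using assms by simp
qed

lemma expectation_abs_le_sqrt:
  assumes "square_integrable M f" "(\<integral>x. (f x)\<^sup>2 \<partial>M) \<le> e" "0 < e"
  shows "(\<integral>x. \<bar>f x\<bar> \<partial>M) \<le> sqrt e"
proof -
  \<comment> \<open>AM-GM with weight \<open>sqrt e\<close>, chosen so that both halves become
    \<open>sqrt e / 2\<close> when the second moment is \<open>e\<close>.\<close>
  have *: "\<bar>a\<bar> \<le> (a\<^sup>2 / sqrt e + sqrt e) / 2" for a :: real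
  proof -
    have "0 \<le> (\<bar>a\<bar> - sqrt e)\<^sup>2 / sqrt e" using assms by simp
    also have "\<dots> = a\<^sup>2 / sqrt e + sqrt e - 2 * \<bar>a\<bar>"
      using assms by (simp add: power2_diff diff_divide_distrib add_divide_distrib real_div_sqrt)
    finally show ?thesis by simp
  qed
  have "(\<integral>x. \<bar>f x\<bar> \<partial>M) \<le> (\<integral>x. ((f x)\<^sup>2 / sqrt e + sqrt e) / 2 \<partial>M)"
    using assms square_integrable_imp_integrable[OF assms(1)] *
    by (intro integral_mono) (auto simp: square_integrable_def)
  also have "\<dots> = ((\<integral>x. (f x)\<^sup>2 \<partial>M) / sqrt e + sqrt e) / 2"
    using assms by (simp add: square_integrable_def prob_space)
  also have "\<dots> \<le> (e / sqrt e + sqrt e) / 2"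
    using assms by (intro divide_right_mono add_mono) auto
  also have "\<dots> = sqrt e" using assms by (simp add: real_div_sqrt)
  finally show ?thesis .
qed

text \<open>\<open>t\<close> and \<open>s\<close> are the parts below and above the level
  \<open>e\<close>. Since \<open>t\<close> lies between 0 and \<open>e\<close>, the variance of
  \<open>t i\<close> is at most \<open>e\<close> times its mean, and these means sum to at most 1.
  The part \<open>s\<close> counts twice, once as itself and once through its mean.\<close>

lemma expectation_sum_lindeberg:
  assumes I: "finite I" and Y: "\<And>i. i \<in> I \<Longrightarrow> integrable M (Y i)" "\<And>i x. i \<in> I \<Longrightarrow> 0 \<le> Y i x"
    and total: "(\<Sum>i\<in>I. \<integral>x. Y i x \<partial>M) = 1" and e: "0 < e"
  defines "t \<equiv> \<lambda>i x. if Y i x \<le> e then Y i x else 0"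
  defines "s \<equiv> \<lambda>i x. if Y i x \<le> e then 0 else Y i x"
  assumes uncorr: "\<And>i j. \<lbrakk>i \<in> I; j \<in> I; i \<noteq> j\<rbrakk> \<Longrightarrow>
      (\<integral>x. (t i x - (\<integral>y. t i y \<partial>M)) * (t j x - (\<integral>y. t j y \<partial>M)) \<partial>M) = 0"
  shows "(\<integral>x. \<bar>(\<Sum>i\<in>I. Y i x) - 1\<bar> \<partial>M) \<le> sqrt e + 2 * (\<Sum>i\<in>I. \<integral>x. s i x \<partial>M)"
proof -
  have meas: "t i \<in> borel_measurable M" "s i \<in> borel_measurable M" if "i \<in> I" for i
    using Y(1)[OF that] unfolding t_def s_def by measurable
  have int: "integrable M (t i)" "integrable M (s i)" if "i \<in> I" for i
    using Y that meas[OF that] by (auto simp: t_def s_def intro!: Bochner_Integration.integrable_bound[OF Y(1)[OF that]])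
  have t: "0 \<le> t i x" "t i x \<le> e" "0 \<le> s i x" if "i \<in> I" for i x
    using Y(2)[OF that] e by (auto simp: t_def s_def)
  have ts: "Y i x = t i x + s i x" for i x by (simp add: t_def s_def)
  define z where "z i x = t i x - (\<integral>y. t i y \<partial>M)" for i x
  have sqt: "square_integrable M (t i)" if "i \<in> I" for i
    using t[OF that] meas[OF that] int[OF that] e
    by (intro square_integrable_bound[where g="\<lambda>x. e * t i x"]) (auto simp: power2_eq_square mult_right_mono)
  have sqz: "square_integrable M (z i)" if "i \<in> I" for i
    unfolding z_def[abs_def] by (intro square_integrable_diff sqt that square_integrable_const)
  have z2: "(\<integral>x. (z i x)\<^sup>2 \<partial>M) \<le> e * (\<integral>x. t i x \<partial>M)" if "i \<in> I" for i
  proof -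
    have "(\<integral>x. (z i x)\<^sup>2 \<partial>M) = (\<integral>x. (t i x)\<^sup>2 \<partial>M) - (\<integral>x. t i x \<partial>M)\<^sup>2"
      unfolding z_def using variance_eq[OF int(1)[OF that]] sqt[OF that] by (simp add: square_integrable_def)
    also have "\<dots> \<le> (\<integral>x. (t i x)\<^sup>2 \<partial>M)" by simp
    also have "\<dots> \<le> (\<integral>x. e * t i x \<partial>M)"
      using t[OF that] int[OF that] sqt[OF that]
      by (intro integral_mono) (auto simp: power2_eq_square mult_right_mono square_integrable_def)
    finally show ?thesis by simp
  qed
  have sum1: "(\<Sum>i\<in>I. \<integral>x. t i x \<partial>M) + (\<Sum>i\<in>I. \<integral>x. s i x \<partial>M) = 1"
    using total int by (simp add: ts sum.distrib)
  have s0: "0 \<le> (\<Sum>i\<in>I. \<integral>x. s i x \<partial>M)"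
    using t by (intro sum_nonneg integral_nonneg_AE) auto
  have "(\<integral>x. (\<Sum>i\<in>I. z i x)\<^sup>2 \<partial>M) = (\<Sum>i\<in>I. \<integral>x. (z i x)\<^sup>2 \<partial>M)"
    using uncorr by (intro square_sum_uncorrelated I sqz) (auto simp: z_def)
  also have "\<dots> \<le> e * (\<Sum>i\<in>I. \<integral>x. t i x \<partial>M)"
    using z2 by (simp add: sum_distrib_left sum_mono)
  also have "\<dots> \<le> e * 1"
    using sum1 s0 e by (intro mult_left_mono) auto
  finally have zsum: "(\<integral>x. \<bar>\<Sum>i\<in>I. z i x\<bar> \<partial>M) \<le> sqrt e"
    using e sqz by (intro expectation_abs_le_sqrt square_integrable_sum) auto
  have int_z: "integrable M (\<lambda>x. \<Sum>i\<in>I. z i x)"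
    using sqz by (intro square_integrable_imp_integrable square_integrable_sum)
  have int_s: "integrable M (\<lambda>x. \<Sum>i\<in>I. s i x)" using int by simp
  have int_Y: "integrable M (\<lambda>x. (\<Sum>i\<in>I. Y i x) - 1)" using Y by simp
  have "\<bar>(\<Sum>i\<in>I. Y i x) - 1\<bar> \<le> \<bar>\<Sum>i\<in>I. z i x\<bar> + (\<Sum>i\<in>I. s i x) + (\<Sum>i\<in>I. \<integral>x. s i x \<partial>M)" for x
  proof -
    have "(\<Sum>i\<in>I. Y i x) - 1 = (\<Sum>i\<in>I. z i x) + (\<Sum>i\<in>I. s i x) - (\<Sum>i\<in>I. \<integral>x. s i x \<partial>M)"
      unfolding z_def using sum1 by (simp add: ts sum.distrib sum_subtractf)
    moreover have "0 \<le> (\<Sum>i\<in>I. s i x)" using t by (intro sum_nonneg)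
    ultimately show ?thesis using s0 by linarith
  qed
  then have "(\<integral>x. \<bar>(\<Sum>i\<in>I. Y i x) - 1\<bar> \<partial>M)
      \<le> (\<integral>x. \<bar>\<Sum>i\<in>I. z i x\<bar> + (\<Sum>i\<in>I. s i x) + (\<Sum>i\<in>I. \<integral>x. s i x \<partial>M) \<partial>M)"
    using int_z int_s int_Y by (intro integral_mono) auto
  also have "\<dots> = (\<integral>x. \<bar>\<Sum>i\<in>I. z i x\<bar> \<partial>M) + 2 * (\<Sum>i\<in>I. \<integral>x. s i x \<partial>M)"
    using int_z int_s int by (simp add: prob_space)
  finally show ?thesis using zsum by simp
qed

end

section \<open>Cluster sums of the projections\<close>

context clustered_kernel
begin

definition cluster_sum :: "nat set \<Rightarrow> 'w \<Rightarrow> real" where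
  "cluster_sum C \<omega> = (\<Sum>i\<in>C. proj i (W i \<omega>))"

text \<open>The target variance without the factor k^2 / n, which cancels in the ratio with the
  estimator.\<close>

definition total_var :: real where
  "total_var = (\<Sum>C\<in>P. \<integral>\<omega>. (cluster_sum C \<omega>)\<^sup>2 \<partial>M)"

lemma target_sd_total_var: "target_sd M S \<phi> k n P W = sqrt ((real k)\<^sup>2 / real n * total_var)"
proof -
  have "(\<integral>\<omega>. (\<Sum>i\<in>C. mean_projection M S \<phi> k P W i \<omega>)\<^sup>2 \<partial>M) = (\<integral>\<omega>. (cluster_sum C \<omega>)\<^sup>2 \<partial>M)"
    if C: "C \<in> P" for C
  proof (rule integral_cong_AE)
    have "AE \<omega> in M. \<forall>i\<in>C. mean_projection M S \<phi> k P W i \<omega> = proj i (W i \<omega>)"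
      using mean_projection_eq finite_cluster[OF C] by (intro AE_finite_allI) auto
    then show "AE \<omega> in M. (\<Sum>i\<in>C. mean_projection M S \<phi> k P W i \<omega>)\<^sup>2 = (cluster_sum C \<omega>)\<^sup>2"
      by eventually_elim (simp add: cluster_sum_def)
  qed (use cluster_subset[OF C] in \<open>auto simp: cluster_sum_def mean_projection_def
        intro!: borel_measurable_power borel_measurable_sum borel_measurable_divide
        measurable_compose[OF obs proj_measurable]\<close>)
  then show ?thesis by (simp add: target_sd_def total_var_def)
qed

lemma square_integrable_cluster_sum: "square_integrable M (cluster_sum C)"
  unfolding cluster_sum_def[abs_def] by (intro square_integrable_sum square_integrable_proj)

text \<open>With the first cluster fixed, integrating out the second leaves a multiple of the mean
  of \<open>g\<close>.\<close>

lemma uncorrelated_clusters: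
  assumes C: "C \<in> P" "C' \<in> P" "C \<noteq> C'"
    and f: "f \<in> borel_measurable (PiM C (\<lambda>_. S))" and g: "g \<in> borel_measurable (PiM C' (\<lambda>_. S))"
    and int: "integrable M (\<lambda>\<omega>. f (obs_at C \<omega>) * g (obs_at C' \<omega>) :: real)"
    and mean: "(\<integral>\<omega>. g (obs_at C' \<omega>) \<partial>M) = 0"
  shows "(\<integral>\<omega>. f (obs_at C \<omega>) * g (obs_at C' \<omega>) \<partial>M) = 0"
proof -
  have "separated P C C'"
    using C part unfolding separated_def partition_on_def disjoint_def by (metis inf_commute)
  then have ind: "indep_var (PiM C (\<lambda>_. S)) (obs_at C) (PiM C' (\<lambda>_. S)) (obs_at C')"
    using C cluster_subset by (intro indep_var_obs_at) auto
  have "(\<lambda>(z, b). f z * g b) \<in> borel_measurable (PiM C (\<lambda>_. S) \<Otimes>\<^sub>M PiM C' (\<lambda>_. S))"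
    using f g by measurable
  from indep_var_integral(2)[OF ind this] int mean show ?thesis by simp
qed

section \<open>Tails and L^1 distance under a uniform bound \<open>b\<close> on the excess of the
  kernel over \<open>K\<close>\<close>

context
  fixes r K b :: real
  assumes r: "1 \<le> r"
    and excess_int: "\<And>xs. length xs = k \<Longrightarrow> set xs \<subseteq> {1..n} \<Longrightarrow>
      integrable M (\<lambda>\<omega>. excess_powr r K (kernel_at \<phi> W xs \<omega>))"
    and excess_le: "\<And>xs. length xs = k \<Longrightarrow> set xs \<subseteq> {1..n} \<Longrightarrow>
      (\<integral>\<omega>. excess_powr r K (kernel_at \<phi> W xs \<omega>) \<partial>M) \<le> b"
    and K: "0 \<le> K"
begin

lemma b_nonneg: "0 \<le> b"
proof -
  have "0 \<le> (\<integral>\<omega>. excess_powr r K (kernel_at \<phi> W (replicate k 1) \<omega>) \<partial>M)"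
    by (simp add: excess_powr_nonneg)
  also have "\<dots> \<le> b" using n by (intro excess_le) auto
  finally show ?thesis .
qed

text \<open>Jensen twice: for the conditional expectation of each completion and for the average
  over completions.\<close>

lemma excess_proj:
  assumes i: "i \<in> {1..n}"
  shows "integrable M (\<lambda>\<omega>. excess_powr r K (proj i (W i \<omega>)))"
    and "(\<integral>\<omega>. excess_powr r K (proj i (W i \<omega>)) \<partial>M) \<le> b"
proof -
  let ?A = "generic_completions P k i"
  note q = convex_excess_powr[OF r, of K] excess_powr_measurable[of r K]
  have *: "integrable M (\<lambda>\<omega>. excess_powr r K (partial_mean xs (W i \<omega>)))"
    "(\<integral>\<omega>. excess_powr r K (partial_mean xs (W i \<omega>)) \<partial>M) \<le> b" if xs: "xs \<in> ?A" for xs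
  proof -
    note D = generic_completionsD[OF xs]
    have set: "set (i # xs) \<subseteq> {1..n}" using D by auto
    note c = partial_mean_convex[OF xs q excess_int[OF D(2) set]]
    show "integrable M (\<lambda>\<omega>. excess_powr r K (partial_mean xs (W i \<omega>)))" by (fact c(1))
    show "(\<integral>\<omega>. excess_powr r K (partial_mean xs (W i \<omega>)) \<partial>M) \<le> b"
      using c(2) excess_le[OF D(2) set] by simp
  qed
  have "integrable M (\<lambda>\<omega>. excess_powr r K (proj i (W i \<omega>))) \<and>
      (\<integral>\<omega>. excess_powr r K (proj i (W i \<omega>)) \<partial>M) \<le> b"
  proof (cases "?A = {}")
    \<comment> \<open>Without generic completions \<open>proj\<close> is 0, and 0 has no excess as
      \<open>K\<close> is nonnegative.\<close>
    case True
    then show ?thesis using K r b_nonneg by (simp add: proj_def excess_powr_def)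
  next
    case False
    then show ?thesis
      unfolding proj_def using *
      by (intro conjI integral_convex_average_le[OF finite_generic_completions False q excess_powr_nonneg]
          partial_mean_obs_measurable) auto
  qed
  then show "integrable M (\<lambda>\<omega>. excess_powr r K (proj i (W i \<omega>)))"
    "(\<integral>\<omega>. excess_powr r K (proj i (W i \<omega>)) \<partial>M) \<le> b" by auto
qed

text \<open>Jensen once more, over the members of the cluster; it is the division by the size that
  keeps the same bound \<open>b\<close>.\<close>

lemma excess_cluster_sum:
  assumes C: "C \<in> P"
  shows "integrable M (\<lambda>\<omega>. excess_powr r K (cluster_sum C \<omega> / real (card C)))"
    and "(\<integral>\<omega>. excess_powr r K (cluster_sum C \<omega> / real (card C)) \<partial>M) \<le> b"
proof -
  have "C \<noteq> {}" using C part by (auto simp: partition_on_def)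
  moreover have "(\<lambda>\<omega>. proj i (W i \<omega>)) \<in> borel_measurable M" if "i \<in> C" for i
    using that cluster_subset[OF C] by (intro measurable_compose[OF obs proj_measurable]) auto
  moreover have "i \<in> {1..n}" if "i \<in> C" for i using that cluster_subset[OF C] by blast
  ultimately have "integrable M (\<lambda>\<omega>. excess_powr r K (cluster_sum C \<omega> / real (card C))) \<and>
    (\<integral>\<omega>. excess_powr r K (cluster_sum C \<omega> / real (card C)) \<partial>M) \<le> b"
    unfolding cluster_sum_def
    by (intro conjI integral_convex_average_le[where b=b] finite_cluster[OF C] convex_excess_powr[OF r]
        excess_powr_measurable excess_powr_nonneg excess_proj)
  then show "integrable M (\<lambda>\<omega>. excess_powr r K (cluster_sum C \<omega> / real (card C)))"
    "(\<integral>\<omega>. excess_powr r K (cluster_sum C \<omega> / real (card C)) \<partial>M) \<le> b" by auto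
qed

text \<open>If \<open>T\<^sup>2 > e V\<close>, then \<open>|T|\<close> exceeds \<open>2 K\<close> times the cluster size, and the power \<open>2 - r\<close> of
  \<open>|T|\<close> is at most the same power of \<open>sqrt (e V)\<close>.\<close>

lemma cluster_tail_le:
  assumes C: "C \<in> P" and r2: "2 \<le> r" and v: "0 < v" and V: "real n * v \<le> V" and e: "0 < e"
    and small: "4 * K\<^sup>2 * (real m)\<^sup>2 \<le> e * v * real n"
  shows "(if (cluster_sum C \<omega>)\<^sup>2 / V \<le> e then 0 else (cluster_sum C \<omega>)\<^sup>2 / V)
    \<le> (e * V) powr (1 - r / 2) / V * (real (card C) powr r * (2 powr r * excess_powr r K (cluster_sum C \<omega> / real (card C))))"
proof (cases "(cluster_sum C \<omega>)\<^sup>2 / V \<le> e")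
  case True
  have "0 < real n * v" using v n by simp
  with V have "0 < V" by linarith
  with True show ?thesis by (simp add: excess_powr_nonneg)
next
  case False
  define T where "T = cluster_sum C \<omega>"
  have "0 < real n * v" using v n by simp
  with V have V0: "0 < V" by linarith
  have large: "e * V < T\<^sup>2" using False V0 by (simp add: T_def field_simps)
  have card0: "0 < real (card C)"
    using C part finite_cluster[OF C] by (auto simp: partition_on_def card_gt_0_iff)
  have T0: "0 < \<bar>T\<bar>" using large mult_pos_pos[OF e V0] by (cases "T = 0") auto
  have "(2 * K * real (card C))\<^sup>2 \<le> (2 * K * real m)\<^sup>2"
    using K max_card[OF C] by (intro power_mono mult_left_mono) auto
  also have "\<dots> \<le> e * v * real n" using small by (simp add: power_mult_distrib)
  also have "\<dots> \<le> e * V" using V e by (simp add: mult.assoc mult.commute[of v])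
  also have "\<dots> \<le> \<bar>T\<bar>\<^sup>2" using large by simp
  finally have "2 * K * real (card C) \<le> \<bar>T\<bar>" by (rule power2_le_imp_le) simp
  then have "2 * K \<le> \<bar>T / real (card C)\<bar>" using card0 by (simp add: field_simps)
  then have "\<bar>T / real (card C)\<bar> powr r \<le> 2 powr r * excess_powr r K (T / real (card C))"
    using r K by (intro powr_le_excess_powr) auto
  then have Tr: "\<bar>T\<bar> powr r \<le> real (card C) powr r * (2 powr r * excess_powr r K (T / real (card C)))"
    using card0 by (simp add: powr_divide field_simps)
  have "T\<^sup>2 = \<bar>T\<bar> powr (2 - r) * \<bar>T\<bar> powr r"
    using T0 by (simp flip: powr_add)
  also have "\<bar>T\<bar> powr (2 - r) = (T\<^sup>2) powr (1 - r / 2)"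
  proof -
    have "T\<^sup>2 = \<bar>T\<bar> powr 2" using T0 by simp
    then have "(T\<^sup>2) powr (1 - r / 2) = (\<bar>T\<bar> powr 2) powr (1 - r / 2)" by (simp only:)
    also have "\<dots> = \<bar>T\<bar> powr (2 - r)" by (simp only: powr_powr) (simp add: algebra_simps)
    finally show ?thesis ..
  qed
  \<comment> \<open>The exponent \<open>1 - r / 2\<close> is at most 0, so the power decreases in
    its base.\<close>
  also have "(T\<^sup>2) powr (1 - r / 2) \<le> (e * V) powr (1 - r / 2)"
    using large e V0 r2 by (intro powr_mono2') auto
  finally have "T\<^sup>2 \<le> (e * V) powr (1 - r / 2) * \<bar>T\<bar> powr r" by (simp add: mult_right_mono)
  also have "\<dots> \<le> (e * V) powr (1 - r / 2) * (real (card C) powr r * (2 powr r * excess_powr r K (T / real (card C))))"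
    by (intro mult_left_mono Tr) simp
  finally have "T\<^sup>2 / V \<le> (e * V) powr (1 - r / 2) * (real (card C) powr r * (2 powr r * excess_powr r K (T / real (card C)))) / V"
    using V0 by (intro divide_right_mono) auto
  with False show ?thesis by (simp add: T_def)
qed

text \<open>The powers of \<open>n\<close> cancel: \<open>V\<close> enters to the power
  \<open>- (r / 2)\<close> and is at least \<open>n * v\<close>, while the size condition bounds the
  sum of \<open>card C powr r\<close> by \<open>(B * n) powr (r / 2)\<close>. What remains is a
  multiple of \<open>b\<close>, free of \<open>n\<close> and of \<open>V\<close>.\<close>

lemma lindeberg_sum_le:
  assumes r2: "2 \<le> r" and v: "0 < v" and V: "real n * v \<le> V" and e: "0 < e"
    and small: "4 * K\<^sup>2 * (real m)\<^sup>2 \<le> e * v * real n"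
    and sizes: "(\<Sum>C\<in>P. real (card C) powr r) powr (2 / r) / real n \<le> B"
  shows "(\<Sum>C\<in>P. \<integral>\<omega>. (if (cluster_sum C \<omega>)\<^sup>2 / V \<le> e then 0 else (cluster_sum C \<omega>)\<^sup>2 / V) \<partial>M)
    \<le> e powr (1 - r / 2) * 2 powr r * (B / v) powr (r / 2) * b"
proof -
  let ?s = "\<lambda>C \<omega>. if (cluster_sum C \<omega>)\<^sup>2 / V \<le> e then 0 else (cluster_sum C \<omega>)\<^sup>2 / V"
  let ?a = "(e * V) powr (1 - r / 2) / V"
  define R where "R = (\<Sum>C\<in>P. real (card C) powr r)"
  have nv: "0 < real n * v" using v n by simp
  with V have V0: "0 < V" by linarith
  have R0: "0 \<le> R" by (simp add: R_def sum_nonneg)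
  have "R = (R powr (2 / r)) powr (r / 2)" using r R0 by (simp add: powr_powr)
  also have "\<dots> \<le> (B * real n) powr (r / 2)"
    using sizes n r by (intro powr_mono2) (auto simp: R_def field_simps)
  finally have R_le: "R \<le> (B * real n) powr (r / 2)" .
  have B0: "0 \<le> B" using sizes by (rule order_trans[rotated]) simp
  have meas: "?s C \<in> borel_measurable M" for C
  proof -
    have [measurable]: "cluster_sum C \<in> borel_measurable M"
      using square_integrable_cluster_sum[of C] by (simp add: square_integrable_def)
    show ?thesis by measurable
  qed
  have "(\<integral>\<omega>. ?s C \<omega> \<partial>M) \<le> ?a * 2 powr r * b * real (card C) powr r" if C: "C \<in> P" for C
  proof -
    have int: "integrable M (\<lambda>\<omega>. ?a * (real (card C) powr r * (2 powr r * excess_powr r K (cluster_sum C \<omega> / real (card C)))))"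
      using excess_cluster_sum[OF C] by (intro integrable_mult_right)
    have "(\<integral>\<omega>. ?s C \<omega> \<partial>M) \<le> (\<integral>\<omega>. ?a * (real (card C) powr r * (2 powr r * excess_powr r K (cluster_sum C \<omega> / real (card C)))) \<partial>M)"
      using cluster_tail_le[OF C r2 v V e small] int V0
      by (intro integral_mono' int) (auto simp: excess_powr_nonneg)
    also have "\<dots> \<le> ?a * (real (card C) powr r * (2 powr r * b))"
      using excess_cluster_sum[OF C] V0 by (simp only: integral_mult_right_zero) (intro mult_left_mono; simp)
    finally show ?thesis by (simp add: mult_ac)
  qed
  then have "(\<Sum>C\<in>P. \<integral>\<omega>. ?s C \<omega> \<partial>M) \<le> (\<Sum>C\<in>P. ?a * 2 powr r * b * real (card C) powr r)"
    by (rule sum_mono)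
  also have "\<dots> = ?a * 2 powr r * b * R" by (simp add: R_def sum_distrib_left)
  also have "\<dots> \<le> ?a * 2 powr r * b * (B * real n) powr (r / 2)"
    using V0 b_nonneg R_le by (intro mult_left_mono) auto
  \<comment> \<open>The division by \<open>V\<close> lowers the exponent from
    \<open>1 - r / 2\<close> to \<open>- (r / 2)\<close>.\<close>
  also have "?a = e powr (1 - r / 2) * V powr (- (r / 2))"
    using e V0 powr_diff[of V "1 - r / 2" 1] by (simp add: powr_mult)
  also have "e powr (1 - r / 2) * V powr (- (r / 2)) * 2 powr r * b * (B * real n) powr (r / 2)
    \<le> e powr (1 - r / 2) * (real n * v) powr (- (r / 2)) * 2 powr r * b * (B * real n) powr (r / 2)"
    using nv V r b_nonneg by (intro mult_right_mono mult_left_mono powr_mono2') auto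
  also have "\<dots> = e powr (1 - r / 2) * 2 powr r * (B / v) powr (r / 2) * b"
  proof -
    have "(real n * v) powr (- (r / 2)) * (B * real n) powr (r / 2) = (B / v) powr (r / 2)"
    proof -
      have "(B * real n) powr (r / 2) / (real n * v) powr (r / 2) = (B * real n / (real n * v)) powr (r / 2)"
        using nv B0 by (subst powr_divide) auto
      also have "B * real n / (real n * v) = B / v" using n by simp
      finally show ?thesis unfolding powr_minus_divide by (simp only: times_divide_eq_left mult_1)
    qed
    from arg_cong[OF this, of "\<lambda>u. e powr (1 - r / 2) * 2 powr r * u * b"] show ?thesis
      by (simp only: mult_ac)
  qed
  finally show ?thesis .
qed

text \<open>The squared cluster sums divided by \<open>total_var\<close> have means summing to 1, so
  the truncation bound applies to them, and \<open>lindeberg_sum_le\<close> controls the part above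
  the level \<open>e\<close>.\<close>

lemma cluster_sums_L1:
  assumes r2: "2 \<le> r" and v: "0 < v" and V: "real n * v \<le> total_var" and e: "0 < e"
    and small: "4 * K\<^sup>2 * (real m)\<^sup>2 \<le> e * v * real n"
    and sizes: "(\<Sum>C\<in>P. real (card C) powr r) powr (2 / r) / real n \<le> B"
  shows "(\<integral>\<omega>. \<bar>(\<Sum>C\<in>P. (cluster_sum C \<omega>)\<^sup>2) / total_var - 1\<bar> \<partial>M)
    \<le> sqrt e + 2 * (e powr (1 - r / 2) * 2 powr r * (B / v) powr (r / 2) * b)"
proof -
  define Y where "Y C \<omega> = (cluster_sum C \<omega>)\<^sup>2 / total_var" for C \<omega>
  have "0 < real n * v" using v n by simp
  with V have V0: "0 < total_var" by linarith
  have intY: "integrable M (Y C)" for C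
    using square_integrable_cluster_sum[of C] unfolding Y_def[abs_def] by (simp add: square_integrable_def)
  have Y0: "0 \<le> Y C \<omega>" for C \<omega> using V0 by (simp add: Y_def)
  have total: "(\<Sum>C\<in>P. \<integral>\<omega>. Y C \<omega> \<partial>M) = 1"
    using V0 by (simp add: Y_def total_var_def flip: sum_divide_distrib)
  let ?t = "\<lambda>C \<omega>. if Y C \<omega> \<le> e then Y C \<omega> else 0"
  have meas_t: "?t C \<in> borel_measurable M" for C
    using intY[of C] by measurable
  have t_le: "\<bar>?t C \<omega>\<bar> \<le> e" for C \<omega> using Y0[of C \<omega>] e by auto
  have sqt: "square_integrable M (?t C)" for C
  proof (rule square_integrable_bound[OF meas_t, where g="\<lambda>_. e\<^sup>2"])
    have "\<bar>?t C \<omega>\<bar>\<^sup>2 \<le> e\<^sup>2" for \<omega> by (intro power_mono t_le) simp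
    then show "AE \<omega> in M. (?t C \<omega>)\<^sup>2 \<le> e\<^sup>2" unfolding power2_abs by (rule AE_I2)
  qed simp
  have uncorr: "(\<integral>\<omega>. (?t C \<omega> - (\<integral>\<omega>. ?t C \<omega> \<partial>M)) * (?t C' \<omega> - (\<integral>\<omega>. ?t C' \<omega> \<partial>M)) \<partial>M) = 0"
    if C: "C \<in> P" "C' \<in> P" "C \<noteq> C'" for C C'
  proof -
    \<comment> \<open>\<open>y\<close> and \<open>f\<close> restate the truncated, centred variables
      as functions on the value space of a cluster, where independence can be applied.\<close>
    define y where "y C z = (\<Sum>i\<in>C. proj i (z i))\<^sup>2 / total_var" for C and z :: "nat \<Rightarrow> 'a"
    define f where "f C z = (if y C z \<le> e then y C z else 0) - (\<integral>\<omega>. ?t C \<omega> \<partial>M)" for C z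
    have y: "y C (obs_at C \<omega>) = Y C \<omega>" for C \<omega>
      unfolding y_def Y_def cluster_sum_def by (simp add: obs_at_def)
    then have f_eq: "f C (obs_at C \<omega>) = ?t C \<omega> - (\<integral>\<omega>. ?t C \<omega> \<partial>M)" for C \<omega>
      unfolding f_def by simp
    have f: "f C \<in> borel_measurable (PiM C (\<lambda>_. S))" for C
    proof -
      have [measurable]: "y C \<in> borel_measurable (PiM C (\<lambda>_. S))"
      proof -
        have "(\<lambda>z. proj i (z i)) \<in> borel_measurable (PiM C (\<lambda>_. S))" if "i \<in> C" for i
        proof -
          have "(\<lambda>z. z i) \<in> PiM C (\<lambda>_. S) \<rightarrow>\<^sub>M S" using that by (rule measurable_component_singleton)
          from measurable_compose[OF this proj_measurable] show ?thesis .
        qed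
        then show ?thesis
          unfolding y_def by (intro borel_measurable_divide borel_measurable_power borel_measurable_sum) auto
      qed
      show ?thesis unfolding f_def by measurable
    qed
    have "(\<integral>\<omega>. f C (obs_at C \<omega>) * f C' (obs_at C' \<omega>) \<partial>M) = 0"
    proof (rule uncorrelated_clusters[OF C f f])
      show "integrable M (\<lambda>\<omega>. f C (obs_at C \<omega>) * f C' (obs_at C' \<omega>))"
        unfolding f_eq by (intro square_integrable_mult square_integrable_diff sqt square_integrable_const)
      show "(\<integral>\<omega>. f C' (obs_at C' \<omega>) \<partial>M) = 0"
        unfolding f_eq using square_integrable_imp_integrable[OF sqt] by (simp add: prob_space)
    qed
    then show ?thesis unfolding f_eq .
  qed
  have "(\<integral>\<omega>. \<bar>(\<Sum>C\<in>P. Y C \<omega>) - 1\<bar> \<partial>M)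
    \<le> sqrt e + 2 * (\<Sum>C\<in>P. \<integral>\<omega>. (if Y C \<omega> \<le> e then 0 else Y C \<omega>) \<partial>M)"
    by (rule expectation_sum_lindeberg[OF finite_P intY Y0 total e uncorr])
  also have "(\<Sum>C\<in>P. \<integral>\<omega>. (if Y C \<omega> \<le> e then 0 else Y C \<omega>) \<partial>M)
    \<le> e powr (1 - r / 2) * 2 powr r * (B / v) powr (r / 2) * b"
    unfolding Y_def by (rule lindeberg_sum_le[OF r2 v V e small sizes])
  finally show ?thesis by (simp add: Y_def flip: sum_divide_distrib)
qed

text \<open>The first two summands come from the law of large numbers. Passing from true to
  estimated cluster sums by \<open>square_diff_le\<close> adds the third, the projection error, and
  the fourth, which is \<open>d\<close> times the mean 1 of the normalised true sum.\<close>

lemma variance_estimator_L1: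
  assumes r2: "2 \<le> r" and v: "0 < v" and V: "real n * v \<le> total_var" and e: "0 < e"
    and small: "4 * K\<^sup>2 * (real m)\<^sup>2 \<le> e * v * real n"
    and sizes: "(\<Sum>C\<in>P. real (card C) powr r) powr (2 / r) / real n \<le> B"
    and d: "0 < d" and n2k: "2 * k \<le> n" and k2: "2 \<le> k"
  defines "Q \<equiv> \<lambda>\<omega>. variance_estimator \<phi> k n P W \<omega> / (target_sd M S \<phi> k n P W)\<^sup>2"
  shows "integrable M (\<lambda>\<omega>. \<bar>Q \<omega> - 1\<bar>)"
    and "(\<integral>\<omega>. \<bar>Q \<omega> - 1\<bar> \<partial>M) \<le> sqrt e + 2 * (e powr (1 - r / 2) * 2 powr r * (B / v) powr (r / 2) * b)
      + (1 + 1 / d) * (24 * c * (real k)\<^sup>2 * 2 ^ k * (real m)\<^sup>2) / (real n * v) + d"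
proof -
  have nv: "0 < real n * v" using v n by simp
  with V have V0: "0 < total_var" by linarith
  define s where "s C \<omega> = (\<Sum>i\<in>C. est_projection \<phi> k n W i \<omega>)" for C \<omega>
  define E where "E C \<omega> = (\<Sum>i\<in>C. est_projection \<phi> k n W i \<omega> - proj i (W i \<omega>))" for C \<omega>
  have E_eq: "E C \<omega> = s C \<omega> - cluster_sum C \<omega>" for C \<omega>
    by (simp add: E_def s_def cluster_sum_def sum_subtractf)
  have "(target_sd M S \<phi> k n P W)\<^sup>2 = (real k)\<^sup>2 / real n * total_var"
    using V0 by (simp add: target_sd_total_var)
  then have Q_eq: "Q \<omega> = (\<Sum>C\<in>P. (s C \<omega>)\<^sup>2) / total_var" for \<omega>
    using n k by (simp add: Q_def variance_estimator_def s_def)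
  have sqE: "square_integrable M (E C)" if "C \<in> P" for C
    unfolding E_def[abs_def] using cluster_subset[OF that] n2k k2
    by (intro square_integrable_sum est_projection_second_moment) auto
  note sqT = square_integrable_cluster_sum
  have sqs: "square_integrable M (s C)" if "C \<in> P" for C
    using square_integrable_diff[OF sqE[OF that] square_integrable_cmult[OF sqT, of "-1" C]]
    by (simp add: E_eq)
  have int_Q: "integrable M Q"
    unfolding Q_eq[abs_def] using sqs by (auto simp: square_integrable_def)
  then show "integrable M (\<lambda>\<omega>. \<bar>Q \<omega> - 1\<bar>)" by simp
  let ?T = "\<lambda>\<omega>. (\<Sum>C\<in>P. (cluster_sum C \<omega>)\<^sup>2) / total_var"
  let ?R = "\<lambda>\<omega>. (1 + 1 / d) * ((\<Sum>C\<in>P. (E C \<omega>)\<^sup>2) / total_var) + d * ?T \<omega>"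
  have le: "\<bar>Q \<omega> - 1\<bar> \<le> \<bar>?T \<omega> - 1\<bar> + ?R \<omega>" for \<omega>
  proof -
    have "\<bar>Q \<omega> - ?T \<omega>\<bar> = \<bar>\<Sum>C\<in>P. (s C \<omega>)\<^sup>2 - (cluster_sum C \<omega>)\<^sup>2\<bar> / total_var"
      using V0 by (simp add: Q_eq sum_subtractf flip: diff_divide_distrib)
    also have "\<dots> \<le> (\<Sum>C\<in>P. (1 + 1 / d) * (E C \<omega>)\<^sup>2 + d * (cluster_sum C \<omega>)\<^sup>2) / total_var"
      using V0 square_diff_le[OF d] unfolding E_eq
      by (intro divide_right_mono order_trans[OF sum_abs] sum_mono) auto
    also have "\<dots> = ?R \<omega>"
      by (simp only: sum.distrib flip: sum_distrib_left) (simp add: add_divide_distrib)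
    finally show ?thesis by linarith
  qed
  have int_E: "integrable M (\<lambda>\<omega>. (\<Sum>C\<in>P. (E C \<omega>)\<^sup>2) / total_var)"
    using sqE by (auto simp: square_integrable_def)
  have int_T: "integrable M ?T"
    using sqT by (auto simp: square_integrable_def)
  have int_T1: "integrable M (\<lambda>\<omega>. \<bar>?T \<omega> - 1\<bar>)" using int_T by simp
  have E_T: "(\<integral>\<omega>. ?T \<omega> \<partial>M) = 1"
    using sqT V0 by (simp add: total_var_def square_integrable_def)
  have E_E: "(\<integral>\<omega>. (\<Sum>C\<in>P. (E C \<omega>)\<^sup>2) / total_var \<partial>M) \<le> 24 * c * (real k)\<^sup>2 * 2 ^ k * (real m)\<^sup>2 / (real n * v)"
  proof -
    have "(\<integral>\<omega>. (\<Sum>C\<in>P. (E C \<omega>)\<^sup>2) / total_var \<partial>M) = (\<Sum>C\<in>P. \<integral>\<omega>. (E C \<omega>)\<^sup>2 \<partial>M) / total_var"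
      using sqE by (simp add: square_integrable_def)
    also have "\<dots> \<le> 24 * c * (real k)\<^sup>2 * 2 ^ k * (real m)\<^sup>2 / total_var"
      unfolding E_def using V0 by (intro divide_right_mono sum_cluster_error_le n2k k2) auto
    also have "\<dots> \<le> 24 * c * (real k)\<^sup>2 * 2 ^ k * (real m)\<^sup>2 / (real n * v)"
      using V nv V0 c_nonneg by (intro divide_left_mono) auto
    finally show ?thesis .
  qed
  have "(\<integral>\<omega>. \<bar>Q \<omega> - 1\<bar> \<partial>M) \<le> (\<integral>\<omega>. \<bar>?T \<omega> - 1\<bar> + ?R \<omega> \<partial>M)"
    by (intro integral_mono le Bochner_Integration.integrable_add integrable_mult_right int_E int_T int_T1)
      (use int_Q in simp)
  also have "\<dots> = (\<integral>\<omega>. \<bar>?T \<omega> - 1\<bar> \<partial>M) + ((1 + 1 / d) * (\<integral>\<omega>. (\<Sum>C\<in>P. (E C \<omega>)\<^sup>2) / total_var \<partial>M) + d * (\<integral>\<omega>. ?T \<omega> \<partial>M))"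
    using int_E int_T int_T1
    by (simp only: Bochner_Integration.integral_add Bochner_Integration.integrable_add integrable_mult_right integral_mult_right_zero)
  also have "\<dots> \<le> (sqrt e + 2 * (e powr (1 - r / 2) * 2 powr r * (B / v) powr (r / 2) * b))
      + ((1 + 1 / d) * (24 * c * (real k)\<^sup>2 * 2 ^ k * (real m)\<^sup>2 / (real n * v)) + d * 1)"
    using d unfolding E_T
    by (intro add_mono mult_left_mono E_E cluster_sums_L1 r2 v V e small sizes) auto
  finally show "(\<integral>\<omega>. \<bar>Q \<omega> - 1\<bar> \<partial>M) \<le> sqrt e + 2 * (e powr (1 - r / 2) * 2 powr r * (B / v) powr (r / 2) * b)
      + (1 + 1 / d) * (24 * c * (real k)\<^sup>2 * 2 ^ k * (real m)\<^sup>2) / (real n * v) + d" by simp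
qed

end

end

section \<open>Consistency\<close>

theorem theorem4:
  fixes M :: "nat \<Rightarrow> 'w measure"
    and S :: "'a measure"
    and W :: "nat \<Rightarrow> nat \<Rightarrow> 'w \<Rightarrow> 'a"
    and P :: "nat \<Rightarrow> nat set set"
    and \<phi> :: "(nat \<Rightarrow> 'a) \<Rightarrow> real"
    and k :: nat
    and r B lb :: real
  assumes k: "k \<ge> 2"
    and r: "r \<ge> 2"
    and prob: "\<And>n. n \<ge> 1 \<Longrightarrow> prob_space (M n)"
    and borel: "standard_borel_space S"
    and clusters: "\<And>n. n \<ge> 1 \<Longrightarrow> partition_on {1..n} (P n)"
    and observations: "\<And>n i. n \<ge> 1 \<Longrightarrow> i \<in> {1..n} \<Longrightarrow> W n i \<in> measurable (M n) S"
    and indep: "\<And>n. n \<ge> 1 \<Longrightarrow> independent_across_clusters (M n) S (P n) (W n)"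
    and kernel_meas: "\<phi> \<in> borel_measurable (PiM {..<k} (\<lambda>_. S))"
    and kernel_sym: "symmetric_kernel k S \<phi>"
    and centred: "\<And>n xs. n \<ge> 1 \<Longrightarrow> length xs = k \<Longrightarrow> cluster_generic (P n) xs \<Longrightarrow>
          (LINT \<omega>|M n. kernel_at \<phi> (W n) xs \<omega>) = 0"
    and size_sum: "\<And>n. n \<ge> 1 \<Longrightarrow>
          (\<Sum>C\<in>P n. real (card C) powr r) powr (2 / r) / real n \<le> B"
    and size_max: "(\<lambda>n. Max ((\<lambda>C. (real (card C))\<^sup>2 / real n) ` P n)) \<longlonglongrightarrow> 0"
    and unif_int: "((\<lambda>K::real. SUP n\<in>{1..}. SUP xs\<in>{xs. length xs = k \<and> set xs \<subseteq> {1..n}}.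
          \<integral>\<^sup>+ \<omega>. ennreal (\<bar>kernel_at \<phi> (W n) xs \<omega>\<bar> powr r) *
             indicator {\<omega>. \<bar>kernel_at \<phi> (W n) xs \<omega>\<bar> > K} \<omega> \<partial>M n) \<longlongrightarrow> 0) at_top"
    and lb_pos: "lb > 0"
    and nondegenerate: "\<forall>\<^sub>F n in sequentially. target_sd (M n) S \<phi> k n (P n) (W n) \<ge> lb"
  shows "converges_in_probability M
     (\<lambda>n \<omega>. variance_estimator \<phi> k n (P n) (W n) \<omega> / (target_sd (M n) S \<phi> k n (P n) (W n))\<^sup>2) 1"
proof -
  define m where "m n = Max (card ` P n)" for n
  \<comment> \<open>With this \<open>v\<close>, the bound \<open>lb\<close> on the target says that
    \<open>total_var\<close> is at least \<open>n * v\<close>.\<close>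
  define v where "v = lb\<^sup>2 / (real k)\<^sup>2"
  have v: "0 < v" using lb_pos k by (simp add: v_def)
  let ?tail = "\<lambda>K n xs. \<integral>\<^sup>+ \<omega>. ennreal (\<bar>kernel_at \<phi> (W n) xs \<omega>\<bar> powr r) *
    indicator {\<omega>. \<bar>kernel_at \<phi> (W n) xs \<omega>\<bar> > K} \<omega> \<partial>M n"
  \<comment> \<open>All large levels qualify; taking one above \<open>K0\<close> makes it at least 1
    for the second moments and nonnegative for the excess.\<close>
  have ui: "\<exists>K\<ge>K0. \<forall>n\<ge>1. \<forall>xs. length xs = k \<and> set xs \<subseteq> {1..n} \<longrightarrow> ?tail K n xs \<le> ennreal h"
    if h: "0 < h" for h K0 :: real
  proof -
    from order_tendstoD(2)[OF unif_int, of "ennreal h"] h obtain K1 where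
      K1: "(SUP n\<in>{1..}. SUP xs\<in>{xs. length xs = k \<and> set xs \<subseteq> {1..n}}. ?tail K n xs) < ennreal h"
      if "K1 \<le> K" for K
      unfolding eventually_at_top_linorder by auto
    have "?tail (max K0 K1) n xs \<le> ennreal h" if "1 \<le> n" "length xs = k \<and> set xs \<subseteq> {1..n}" for n xs
    proof -
      have "?tail (max K0 K1) n xs \<le> (SUP xs\<in>{xs. length xs = k \<and> set xs \<subseteq> {1..n}}. ?tail (max K0 K1) n xs)"
        using that by (intro SUP_upper) simp
      also have "\<dots> \<le> (SUP n\<in>{1..}. SUP xs\<in>{xs. length xs = k \<and> set xs \<subseteq> {1..n}}. ?tail (max K0 K1) n xs)"
        using that by (intro SUP_upper) simp
      finally show ?thesis using K1[of "max K0 K1"] by simp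
    qed
    then show ?thesis by (intro exI[of _ "max K0 K1"]) auto
  qed
  have meas: "kernel_at \<phi> (W n) xs \<in> borel_measurable (M n)"
    if "1 \<le> n" "length xs = k" "set xs \<subseteq> {1..n}" for n xs
  proof -
    have "(\<lambda>\<omega>. \<lambda>j\<in>{..<k}. W n (xs ! j) \<omega>) \<in> M n \<rightarrow>\<^sub>M PiM {..<k} (\<lambda>_. S)"
      using that by (intro measurable_restrict observations) (auto simp: subset_iff)
    from measurable_compose[OF this kernel_meas] show ?thesis
      using that by (simp add: kernel_at_def[abs_def])
  qed
  \<comment> \<open>One fixed tail level already yields a second moment bound \<open>c\<close> valid
    for all \<open>n\<close> and all tuples.\<close>
  obtain K1 where K1: "1 \<le> K1"
    and tail1: "\<And>n xs. 1 \<le> n \<Longrightarrow> length xs = k \<and> set xs \<subseteq> {1..n} \<Longrightarrow> ?tail K1 n xs \<le> ennreal 1"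
    using ui[of 1 1] by auto
  define c where "c = K1\<^sup>2 + 1"
  have c0: "0 \<le> c" by (simp add: c_def)
  have sq: "square_integrable (M n) (kernel_at \<phi> (W n) xs)"
    and sq_le: "(LINT \<omega>|M n. (kernel_at \<phi> (W n) xs \<omega>)\<^sup>2) \<le> c"
    if n: "1 \<le> n" "length xs = k" "set xs \<subseteq> {1..n}" for n xs
  proof -
    interpret prob_space "M n" using prob n(1) .
    let ?X = "kernel_at \<phi> (W n) xs"
    let ?g = "\<lambda>\<omega>. \<bar>?X \<omega>\<bar> powr r * indicator {x. K1 < \<bar>x\<bar>} (?X \<omega>)"
    have g: "integrable (M n) ?g" "(\<integral>\<omega>. ?g \<omega> \<partial>M n) \<le> 1"
      using tail_powr_integrable[OF meas[OF n], of 1 r K1] tail1 n by auto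
    have le: "(?X \<omega>)\<^sup>2 \<le> K1\<^sup>2 + ?g \<omega>" for \<omega>
      by (rule power2_le_tail_powr[OF K1 r])
    show sq: "square_integrable (M n) ?X"
      using le g by (intro square_integrable_bound[OF meas[OF n], where g="\<lambda>\<omega>. K1\<^sup>2 + ?g \<omega>"]) auto
    have "(\<integral>\<omega>. (?X \<omega>)\<^sup>2 \<partial>M n) \<le> (\<integral>\<omega>. K1\<^sup>2 + ?g \<omega> \<partial>M n)"
      using le g sq by (intro integral_mono) (auto simp: square_integrable_def)
    also have "\<dots> = K1\<^sup>2 + (\<integral>\<omega>. ?g \<omega> \<partial>M n)" using g by (simp add: prob_space)
    finally show "(LINT \<omega>|M n. (?X \<omega>)\<^sup>2) \<le> c" using g by (simp add: c_def)
  qed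
  have finite_P: "finite (P n)" "P n \<noteq> {}" if "1 \<le> n" for n
  proof -
    have U: "\<Union>(P n) = {1..n}" using clusters[OF that] by (simp add: partition_on_def)
    then show "finite (P n)" by (metis finite_UnionD finite_atLeastAtMost)
    show "P n \<noteq> {}"
    proof
      assume "P n = {}"
      with U have "{1..n} = {}" by simp
      with that show False by simp
    qed
  qed
  have ck: "clustered_kernel (M n) S (W n) (P n) \<phi> k n (m n) c" if n: "1 \<le> n" for n
  proof -
    interpret prob_space "M n" using prob n .
    show ?thesis
    proof
      show "card C \<le> m n" if "C \<in> P n" for C
        using that finite_P[OF n] by (simp add: m_def)
    qed (use k n clusters observations indep kernel_meas centred sq sq_le in auto)
  qed
  have m_limit: "(\<lambda>n. (real (m n))\<^sup>2 / real n) \<longlonglongrightarrow> 0"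
  proof (rule tendsto_sandwich[OF _ _ tendsto_const size_max])
    show "\<forall>\<^sub>F n in sequentially. (real (m n))\<^sup>2 / real n \<le> Max ((\<lambda>C. (real (card C))\<^sup>2 / real n) ` P n)"
      using eventually_ge_at_top[of 1]
    proof eventually_elim
      fix n :: nat assume n: "1 \<le> n"
      then have "m n \<in> card ` P n" unfolding m_def using finite_P by (intro Max_in) auto
      then show "(real (m n))\<^sup>2 / real n \<le> Max ((\<lambda>C. (real (card C))\<^sup>2 / real n) ` P n)"
        using finite_P[OF n] by (intro Max_ge) auto
    qed
  qed simp
  let ?Q = "\<lambda>n \<omega>. variance_estimator \<phi> k n (P n) (W n) \<omega> / (target_sd (M n) S \<phi> k n (P n) (W n))\<^sup>2"
  have L1: "\<forall>\<^sub>F n in sequentially. n \<ge> 1 \<and> integrable (M n) (\<lambda>\<omega>. \<bar>?Q n \<omega> - 1\<bar>) \<and> (\<integral>\<omega>. \<bar>?Q n \<omega> - 1\<bar> \<partial>M n) \<le> g"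
    if g: "0 < g" for g
  proof -
    \<comment> \<open>Four contributions of at most \<open>g / 4\<close> each. The order of choice
      matters: \<open>e\<close> and \<open>d\<close> first, then \<open>X\<close>, which depends on
      \<open>e\<close>, then \<open>h\<close> small against \<open>X\<close>, then the level
      \<open>K\<close> for \<open>h\<close>, and \<open>n\<close> last.\<close>
    define e where "e = (g / 4)\<^sup>2"
    define d where "d = g / 4"
    define X where "X = e powr (1 - r / 2) * 2 powr r * (B / v) powr (r / 2)"
    define h where "h = g / (8 * (X + 1))"
    define D where "D = (1 + 1 / d) * (24 * c * (real k)\<^sup>2 * 2 ^ k)"
    have e: "0 < e" and d: "0 < d" and sqrt_e: "sqrt e = g / 4" using g by (auto simp: e_def d_def)
    have X0: "0 \<le> X" by (simp add: X_def)
    have h: "0 < h" using g X0 by (simp add: h_def)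
    have D0: "0 \<le> D" using d c0 by (simp add: D_def)
    have "8 * (X * h) \<le> g"
    proof -
      have "h * (8 * (X + 1)) = g" using X0 unfolding h_def by simp
      then have "8 * (X * h) + 8 * h = g" by (simp add: algebra_simps)
      with h show ?thesis by linarith
    qed
    then have Xh: "2 * (X * h) \<le> g / 4" by simp
    obtain K where K: "0 \<le> K"
      and tailK: "\<And>n xs. 1 \<le> n \<Longrightarrow> length xs = k \<and> set xs \<subseteq> {1..n} \<Longrightarrow> ?tail K n xs \<le> ennreal h"
      using ui[OF h, of 0] by auto
    \<comment> \<open>A threshold for \<open>m\<^sup>2 / n\<close>: the first entry yields
      \<open>small\<close>, the second the bound on the projection error; adding 1 keeps both
      denominators positive.\<close>
    define \<tau> where "\<tau> = min (e * v / (4 * K\<^sup>2 + 1)) (g / 4 * v / (D + 1))"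
    have \<tau>: "0 < \<tau>" using e v g D0 unfolding \<tau>_def by (simp add: add_nonneg_pos)
    from order_tendstoD(2)[OF m_limit \<tau>] eventually_ge_at_top[of "2 * k"] nondegenerate
    show ?thesis
    proof eventually_elim
      case (elim n)
      have n: "1 \<le> n" using elim(2) k by simp
      interpret clustered_kernel "M n" S "W n" "P n" \<phi> k n "m n" c by (rule ck[OF n])
      let ?y = "(real (m n))\<^sup>2 / real n"
      have V: "real n * v \<le> total_var"
      proof -
        have "lb \<le> sqrt ((real k)\<^sup>2 / real n * total_var)"
          using elim(3) unfolding target_sd_total_var .
        then have "lb\<^sup>2 \<le> (real k)\<^sup>2 / real n * total_var"
          using lb_pos by (metis less_eq_real_def real_le_rsqrt real_sqrt_le_iff real_sqrt_unique order_trans abs_of_pos real_sqrt_abs)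
        then show ?thesis using n k by (simp add: v_def field_simps)
      qed
      have y0: "0 \<le> ?y" by simp
      have y1: "?y \<le> e * v / (4 * K\<^sup>2 + 1)" and y2: "?y \<le> g / 4 * v / (D + 1)"
        using elim(1) unfolding \<tau>_def by linarith+
      have "0 < 4 * K\<^sup>2 + 1" by (simp add: add_nonneg_pos)
      from y1 have "?y * (4 * K\<^sup>2 + 1) \<le> e * v"
        unfolding pos_le_divide_eq[OF \<open>0 < 4 * K\<^sup>2 + 1\<close>] .
      then have "?y * (4 * K\<^sup>2) \<le> e * v" using y0 by (simp only: distrib_left mult_1_right)
      then have "?y * (4 * K\<^sup>2) * real n \<le> e * v * real n" by (intro mult_right_mono) auto
      then have small: "4 * K\<^sup>2 * (real (m n))\<^sup>2 \<le> e * v * real n"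
        using n by (simp add: mult.commute)
      have "0 < D + 1" using D0 by simp
      from y2 have "?y * (D + 1) \<le> g / 4 * v"
        unfolding pos_le_divide_eq[OF \<open>0 < D + 1\<close>] .
      then have "?y * D \<le> g / 4 * v" using y0 by (simp only: distrib_left mult_1_right)
      then have "?y * D / v \<le> g / 4" unfolding pos_divide_le_eq[OF v] .
      then have small2: "D * (real (m n))\<^sup>2 / (real n * v) \<le> g / 4"
        by (simp add: mult.commute)
      have ex: "integrable (M n) (\<lambda>\<omega>. excess_powr r K (kernel_at \<phi> (W n) xs \<omega>))"
        "(\<integral>\<omega>. excess_powr r K (kernel_at \<phi> (W n) xs \<omega>) \<partial>M n) \<le> h"
        if xs: "length xs = k" "set xs \<subseteq> {1..n}" for xs
      proof -
        let ?X = "kernel_at \<phi> (W n) xs"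
        let ?g = "\<lambda>\<omega>. \<bar>?X \<omega>\<bar> powr r * indicator {x. K < \<bar>x\<bar>} (?X \<omega>)"
        have g: "integrable (M n) ?g" "(\<integral>\<omega>. ?g \<omega> \<partial>M n) \<le> h"
          using tail_powr_integrable[OF meas[OF n xs], of h r K] tailK n xs h by auto
        have le: "excess_powr r K (?X \<omega>) \<le> ?g \<omega>" for \<omega>
          using r K by (intro excess_powr_le) auto
        show int: "integrable (M n) (\<lambda>\<omega>. excess_powr r K (?X \<omega>))"
          using le excess_powr_nonneg[of r K]
          by (intro Bochner_Integration.integrable_bound[OF g(1)] measurable_compose[OF meas[OF n xs] excess_powr_measurable]) auto
        have "(\<integral>\<omega>. excess_powr r K (?X \<omega>) \<partial>M n) \<le> (\<integral>\<omega>. ?g \<omega> \<partial>M n)"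
          by (intro integral_mono int g(1) le)
        with g(2) show "(\<integral>\<omega>. excess_powr r K (?X \<omega>) \<partial>M n) \<le> h" by simp
      qed
      have r1: "1 \<le> r" using r by simp
      note L = variance_estimator_L1[OF r1 ex K r v V e small size_sum[OF n] d elim(2) assms(1)]
      have "(\<integral>\<omega>. \<bar>?Q n \<omega> - 1\<bar> \<partial>M n) \<le> g / 4 + 2 * (X * h) + D * (real (m n))\<^sup>2 / (real n * v) + d"
        using L(2) unfolding sqrt_e X_def[symmetric] by (simp add: D_def mult.assoc)
      also have "\<dots> \<le> g" using Xh small2 unfolding d_def by linarith
      finally show ?case using n L(1) by simp
    qed
  qed
  show ?thesis
    unfolding converges_in_probability_def
  proof (intro allI impI)
    fix \<epsilon> :: real assume \<epsilon>: "0 < \<epsilon>"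
    show "(\<lambda>n. measure (M n) {\<omega> \<in> space (M n). \<bar>?Q n \<omega> - 1\<bar> > \<epsilon>}) \<longlonglongrightarrow> 0"
    proof (rule tendstoI)
      fix \<gamma> :: real assume \<gamma>: "0 < \<gamma>"
      \<comment> \<open>Markov's inequality divides the mean by \<open>\<epsilon>\<close>; the
        factor one half makes the final inequality strict.\<close>
      have "0 < \<epsilon> * \<gamma> / 2" using \<epsilon> \<gamma> by simp
      from L1[OF this]
      show "\<forall>\<^sub>F n in sequentially. dist (measure (M n) {\<omega> \<in> space (M n). \<bar>?Q n \<omega> - 1\<bar> > \<epsilon>}) 0 < \<gamma>"
      proof eventually_elim
        case (elim n)
        then interpret prob_space "M n" using prob by blast
        have meas: "(\<lambda>\<omega>. \<bar>?Q n \<omega> - 1\<bar>) \<in> borel_measurable (M n)" using elim by auto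
        have "measure (M n) {\<omega> \<in> space (M n). \<bar>?Q n \<omega> - 1\<bar> > \<epsilon>}
            \<le> measure (M n) {\<omega> \<in> space (M n). \<epsilon> \<le> \<bar>?Q n \<omega> - 1\<bar>}"
          using meas by (intro finite_measure_mono) (auto intro!: borel_measurable_le)
        also have "\<dots> \<le> (\<integral>\<omega>. \<bar>?Q n \<omega> - 1\<bar> \<partial>M n) / \<epsilon>"
          using elim \<epsilon> by (intro integral_Markov_inequality_measure[where A="{}"]) auto
        also have "\<dots> \<le> (\<epsilon> * \<gamma> / 2) / \<epsilon>"
          using elim \<epsilon> by (intro divide_right_mono) auto
        also have "\<dots> < \<gamma>" using \<epsilon> \<gamma> by simp
        finally show ?case by (simp add: measure_nonneg)
      qed
    qed
  qed
qed

end
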